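(* Let $\mathsf G$ be a unimodular Lie group and let $E\to\mathsf G$ be a left-invariant exact Courant algebroid with infinitesimal data $(\mathfrak G=\mathfrak g\oplus\mathfrak g^*,\langle\cdot,\cdot\rangle,\mu_H)$. Then the generalized Ricci curvature of an invariant generalized metric $\mathcal G$ satisfies $$\mathcal Rc(\mathcal G)=-2\,(\mathrm{grad}_{g^{\rm sym}}\mathcal S)_{\mathcal G},$$ where the gradient of the generalized scalar curvature $\mathcal S$ is taken with respect to the symmetric metric $g^{\rm sym}$ on the space $\mathcal M^{\mathfrak G}_{\rm gen}$ of invariant generalized metrics.
   Context: $(\mathfrak g,\mu)$ is the Lie algebra of $\mathsf G$, $H\in\Lambda^3\mathfrak g^*$ is closed, $\langle X+\xi,Y+\eta\rangle=\tfrac12(\xi(Y)+\eta(X))$, and $\mu_H(X+\xi,Y+\eta)=\mu(X,Y)-\eta\circ\mathrm{ad}_\mu(X)+\xi\circ\mathrm{ad}_\mu(Y)+\iota_Y\iota_XH$. $\mathcal M^{\mathfrak G}_{\rm gen}$ is the set of $\mathcal G\in\mathsf{SO}(\mathfrak G,\langle\cdot,\cdot\rangle)$ with $\mathcal G^2=\mathrm{Id}$ and $\langle\mathcal G\cdot,\cdot\rangle$ positive definite. Each such $\mathcal G$ is uniquely $e^b\begin{pmatrix}0&g^{-1}\\ g&0\end{pmatrix}e^{-b}$, $e^b(X+\xi)=X+\xi+\iota_Xb$, with $g$ an inner product on $\mathfrak g$ and $b\in\Lambda^2\mathfrak g^*$; put $H_{\mathcal G}=H+db$. Tangent vectors to $\mathcal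 M^{\mathfrak G}_{\rm gen}$ at $\mathcal G$ are identified with endomorphisms $A\in\mathfrak{so}(\mathfrak G,\langle\cdot,\cdot\rangle)\cap\mathrm{Sym}(\mathfrak G,\mathcal G)$ via $\dot{\mathcal G}=\mathcal GA$ (equivalently, the variation of the inner product $h=2\langle\mathcal G\cdot,\cdot\rangle$ is $h(A\cdot,\cdot)$), where $\mathrm{Sym}(\mathfrak G,\mathcal G)$ denotes endomorphisms symmetric for $2\langle\mathcal G\cdot,\cdot\rangle$. The symmetric metric is $g^{\rm sym}_{\mathcal G}(A,B)=\mathrm{tr}(AB)$. With $g$ extended to tensors so that tensor products of orthonormal basis vectors are orthonormal ($|H|^2=\sum_{i,j,k}H_{ijk}^2$, $H^2(X,Y)=g(\iota_XH,\iota_YH)$) and $d_g^*$ the codifferential, $$\mathcal Rc(\mathcal G)=e^b\begin{pmatrix}R&\tfrac12g^{-1}(d_g^*H_{\mathcal G})g^{-1}\\-\tfrac12d_g^*H_{\mathcal G}&-R^*\end{pmatrix}e^{-b},\quad R=g^{-1}(\mathrm{Ric}_g-\tfrac14H_{\mathcal G}^2),\qquad \mathcal S(\mathcal G)=\mathrm{scal}(g)-\tfrac1{12}|H_{\mathcal G}|^2 .$$ *)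

theory Defs
  imports "HOL-Analysis.Analysis"
begin

text \<open>
  The Lie algebra is a finite-dimensional real vector space \<open>'a :: euclidean_space\<close> with a bracket
  \<open>mu\<close>; the inner product that comes with the type class plays no mathematical role (\<open>Basis\<close> is
  only used as some basis, to write down traces). The class forces positive dimension.
  A left-invariant tensor is its value at the identity, so that left-invariant functions are
  constants and terms differentiating them drop out of the formulas below.
\<close>

type_synonym 'a dual = "'a \<Rightarrow>\<^sub>L real"
type_synonym 'a double = "'a \<times> 'a dual"
type_synonym 'a endo = "'a double \<Rightarrow>\<^sub>L 'a double"


subsection \<open>Lie algebra, forms, Courant data\<close>

definition lin_trace :: "('a::euclidean_space \<Rightarrow> 'a) \<Rightarrow> real" where
  "lin_trace f = (\<Sum>i\<in>Basis. f i \<bullet> i)"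

definition lie_bracket :: "('a::euclidean_space \<Rightarrow> 'a \<Rightarrow> 'a) \<Rightarrow> bool" where
  "lie_bracket mu \<longleftrightarrow> bilinear mu \<and> (\<forall>X. mu X X = 0) \<and>
     (\<forall>X Y Z. mu X (mu Y Z) + mu Y (mu Z X) + mu Z (mu X Y) = 0)"

definition unimodular :: "('a::euclidean_space \<Rightarrow> 'a \<Rightarrow> 'a) \<Rightarrow> bool" where
  "unimodular mu \<longleftrightarrow> (\<forall>X. lin_trace (mu X) = 0)"

definition two_form :: "('a::euclidean_space \<Rightarrow> 'a \<Rightarrow> real) \<Rightarrow> bool" where
  "two_form b \<longleftrightarrow> bilinear b \<and> (\<forall>X. b X X = 0)"

definition three_form :: "('a::euclidean_space \<Rightarrow> 'a \<Rightarrow> 'a \<Rightarrow> real) \<Rightarrow> bool" where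
  "three_form H \<longleftrightarrow> (\<forall>X. bilinear (H X)) \<and> (\<forall>Y Z. linear (\<lambda>X. H X Y Z)) \<and>
     (\<forall>X Y. H X X Y = 0 \<and> H X Y Y = 0)"

text \<open>The exterior derivative of left-invariant forms (Chevalley--Eilenberg), in degrees 2 and 3.\<close>

definition d2 :: "('a \<Rightarrow> 'a \<Rightarrow> 'a) \<Rightarrow> ('a \<Rightarrow> 'a \<Rightarrow> real) \<Rightarrow> 'a::euclidean_space \<Rightarrow> 'a \<Rightarrow> 'a \<Rightarrow> real" where
  "d2 mu b X Y Z = - b (mu X Y) Z + b (mu X Z) Y - b (mu Y Z) X"

definition d3 :: "('a \<Rightarrow> 'a \<Rightarrow> 'a) \<Rightarrow> ('a \<Rightarrow> 'a \<Rightarrow> 'a \<Rightarrow> real) \<Rightarrow>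
    'a::euclidean_space \<Rightarrow> 'a \<Rightarrow> 'a \<Rightarrow> 'a \<Rightarrow> real" where
  "d3 mu H X Y Z W =
     - H (mu X Y) Z W + H (mu X Z) Y W - H (mu X W) Y Z
     - H (mu Y Z) X W + H (mu Y W) X Z - H (mu Z W) X Y"

text \<open>
  \<open>Blinfun\<close> turns a bounded linear function into an element of the type of bounded operators and is
  unspecified on other functions. Everything it is applied to below is linear on a
  finite-dimensional space, hence bounded.
\<close>

text \<open>The map from the Lie algebra to its dual sending \<open>X\<close> to \<open>f X \<cdot>\<close>; for a 2-form \<open>b\<close> this is
  \<open>X \<mapsto> \<iota>\<^sub>X b\<close>.\<close>

definition flat_op :: "('a::euclidean_space \<Rightarrow> 'a \<Rightarrow> real) \<Rightarrow> 'a \<Rightarrow>\<^sub>L 'a dual" where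
  "flat_op f = Blinfun (\<lambda>X. Blinfun (f X))"

fun pairing :: "'a::euclidean_space double \<Rightarrow> 'a double \<Rightarrow> real" where
  "pairing (X, \<xi>) (Y, \<eta>) = (\<xi> Y + \<eta> X) / 2"

fun courant_bracket :: "('a \<Rightarrow> 'a \<Rightarrow> 'a) \<Rightarrow> ('a \<Rightarrow> 'a \<Rightarrow> 'a \<Rightarrow> real) \<Rightarrow>
    'a::euclidean_space double \<Rightarrow> 'a double \<Rightarrow> 'a double" where
  "courant_bracket mu H (X, \<xi>) (Y, \<eta>) =
     (mu X Y, - (\<eta> o\<^sub>L Blinfun (mu X)) + (\<xi> o\<^sub>L Blinfun (mu Y)) + Blinfun (H X Y))"

definition exact_courant_data :: "('a::euclidean_space \<Rightarrow> 'a \<Rightarrow> 'a) \<Rightarrow> ('a \<Rightarrow> 'a \<Rightarrow> 'a \<Rightarrow> real) \<Rightarrow>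
    ('a double \<Rightarrow> 'a double \<Rightarrow> 'a double) \<Rightarrow> bool" where
  "exact_courant_data mu H muH \<longleftrightarrow>
     lie_bracket mu \<and> three_form H \<and> (\<forall>X Y Z W. d3 mu H X Y Z W = 0) \<and>
     muH = courant_bracket mu H"


subsection \<open>Riemannian geometry of a left-invariant metric\<close>

definition inner_product :: "('a::euclidean_space \<Rightarrow> 'a \<Rightarrow> real) \<Rightarrow> bool" where
  "inner_product g \<longleftrightarrow> bilinear g \<and> (\<forall>X Y. g X Y = g Y X) \<and> (\<forall>X. X \<noteq> 0 \<longrightarrow> g X X > 0)"

definition orthonormal_basis :: "('a::euclidean_space \<Rightarrow> 'a \<Rightarrow> real) \<Rightarrow> 'a set \<Rightarrow> bool" where
  "orthonormal_basis g E \<longleftrightarrow> finite E \<and> span E = UNIV \<and>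
     (\<forall>x\<in>E. \<forall>y\<in>E. g x y = (if x = y then 1 else 0))"

definition onb :: "('a::euclidean_space \<Rightarrow> 'a \<Rightarrow> real) \<Rightarrow> 'a set" where
  "onb g = (SOME E. orthonormal_basis g E)"

definition levi_civita :: "('a \<Rightarrow> 'a \<Rightarrow> 'a) \<Rightarrow> ('a \<Rightarrow> 'a \<Rightarrow> real) \<Rightarrow> 'a::euclidean_space \<Rightarrow> 'a \<Rightarrow> 'a" where
  "levi_civita mu g = (THE D. bilinear D \<and> (\<forall>X Y. D X Y - D Y X = mu X Y) \<and>
     (\<forall>X Y Z. g (D X Y) Z + g Y (D X Z) = 0))"

definition curvature :: "('a \<Rightarrow> 'a \<Rightarrow> 'a) \<Rightarrow> ('a \<Rightarrow> 'a \<Rightarrow> real) \<Rightarrow>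
    'a::euclidean_space \<Rightarrow> 'a \<Rightarrow> 'a \<Rightarrow> 'a" where
  "curvature mu g X Y Z = (let D = levi_civita mu g in
     D X (D Y Z) - D Y (D X Z) - D (mu X Y) Z)"

definition ricci :: "('a \<Rightarrow> 'a \<Rightarrow> 'a) \<Rightarrow> ('a \<Rightarrow> 'a \<Rightarrow> real) \<Rightarrow> 'a::euclidean_space \<Rightarrow> 'a \<Rightarrow> real" where
  "ricci mu g Y Z = lin_trace (\<lambda>X. curvature mu g X Y Z)"

definition scal :: "('a::euclidean_space \<Rightarrow> 'a \<Rightarrow> 'a) \<Rightarrow> ('a \<Rightarrow> 'a \<Rightarrow> real) \<Rightarrow> real" where
  "scal mu g = (\<Sum>e\<in>onb g. ricci mu g e e)"

definition norm_sq3 :: "('a::euclidean_space \<Rightarrow> 'a \<Rightarrow> real) \<Rightarrow> ('a \<Rightarrow> 'a \<Rightarrow> 'a \<Rightarrow> real) \<Rightarrow> real" where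
  "norm_sq3 g H = (\<Sum>i\<in>onb g. \<Sum>j\<in>onb g. \<Sum>k\<in>onb g. (H i j k)\<^sup>2)"

definition square3 :: "('a \<Rightarrow> 'a \<Rightarrow> real) \<Rightarrow> ('a \<Rightarrow> 'a \<Rightarrow> 'a \<Rightarrow> real) \<Rightarrow>
    'a::euclidean_space \<Rightarrow> 'a \<Rightarrow> real" where
  "square3 g H X Y = (\<Sum>i\<in>onb g. \<Sum>j\<in>onb g. H X i j * H Y i j)"

definition nabla3 :: "('a \<Rightarrow> 'a \<Rightarrow> 'a) \<Rightarrow> ('a \<Rightarrow> 'a \<Rightarrow> real) \<Rightarrow> ('a \<Rightarrow> 'a \<Rightarrow> 'a \<Rightarrow> real) \<Rightarrow>
    'a::euclidean_space \<Rightarrow> 'a \<Rightarrow> 'a \<Rightarrow> 'a \<Rightarrow> real" where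
  "nabla3 mu g H W X Y Z = (let D = levi_civita mu g in
     - H (D W X) Y Z - H X (D W Y) Z - H X Y (D W Z))"

text \<open>
  The codifferential on 3-forms, as minus the divergence. It is the formal adjoint of \<open>d\<close> for the
  inner product of differential forms, i.e. the tensor inner product divided by \<open>k!\<close> on \<open>k\<close>-forms
  (an adjoint for the undivided tensor inner products would be three times as large).
\<close>

definition codiff3 :: "('a \<Rightarrow> 'a \<Rightarrow> 'a) \<Rightarrow> ('a \<Rightarrow> 'a \<Rightarrow> real) \<Rightarrow> ('a \<Rightarrow> 'a \<Rightarrow> 'a \<Rightarrow> real) \<Rightarrow>
    'a::euclidean_space \<Rightarrow> 'a \<Rightarrow> real" where
  "codiff3 mu g H X Y = - (\<Sum>e\<in>onb g. nabla3 mu g H e e X Y)"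


subsection \<open>Generalized metrics\<close>

definition block_op :: "('a \<Rightarrow>\<^sub>L 'a) \<Rightarrow> ('a dual \<Rightarrow>\<^sub>L 'a) \<Rightarrow> ('a \<Rightarrow>\<^sub>L 'a dual) \<Rightarrow> ('a dual \<Rightarrow>\<^sub>L 'a dual) \<Rightarrow>
    'a::euclidean_space endo" where
  "block_op A B C D = Blinfun (\<lambda>(X, \<xi>). (A X + B \<xi>, C X + D \<xi>))"

definition exp_b :: "('a::euclidean_space \<Rightarrow> 'a \<Rightarrow> real) \<Rightarrow> 'a endo" where
  "exp_b b = block_op id_blinfun 0 (flat_op b) id_blinfun"

definition sharp_op :: "('a::euclidean_space \<Rightarrow> 'a \<Rightarrow> real) \<Rightarrow> 'a dual \<Rightarrow>\<^sub>L 'a" where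
  "sharp_op g = Blinfun (inv (blinfun_apply (flat_op g)))"

definition dual_op :: "('a::euclidean_space \<Rightarrow>\<^sub>L 'a) \<Rightarrow> 'a dual \<Rightarrow>\<^sub>L 'a dual" where
  "dual_op R = Blinfun (\<lambda>\<xi>. \<xi> o\<^sub>L R)"

text \<open>
  The orthogonality condition does not include \<open>det = 1\<close>: an involution with \<open>\<langle>\<G>\<cdot>,\<cdot>\<rangle>\<close> positive
  definite has determinant \<open>(-1)\<^sup>n\<close> with \<open>n\<close> the dimension of the Lie algebra, so for odd \<open>n\<close> that
  condition would leave no generalized metrics, and for even \<open>n\<close> it is automatic.
\<close>

definition gen_metrics :: "'a::euclidean_space endo set" where
  "gen_metrics = {G. (\<forall>u v. pairing (blinfun_apply G u) (G v) = pairing u v) \<and> G o\<^sub>L G = id_blinfun \<and>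
     (\<forall>u. u \<noteq> 0 \<longrightarrow> pairing (G u) u > 0)}"

definition gen_metric_of :: "('a \<Rightarrow> 'a \<Rightarrow> real) \<Rightarrow> ('a \<Rightarrow> 'a \<Rightarrow> real) \<Rightarrow> 'a::euclidean_space endo" where
  "gen_metric_of g b =
     exp_b b o\<^sub>L block_op 0 (sharp_op g) (flat_op g) 0 o\<^sub>L exp_b (\<lambda>X Y. - b X Y)"

definition metric_b_field :: "'a::euclidean_space endo \<Rightarrow> ('a \<Rightarrow> 'a \<Rightarrow> real) \<times> ('a \<Rightarrow> 'a \<Rightarrow> real)" where
  "metric_b_field G =
     (THE p. inner_product (fst p) \<and> two_form (snd p) \<and> G = gen_metric_of (fst p) (snd p))"

definition H_of :: "('a \<Rightarrow> 'a \<Rightarrow> 'a) \<Rightarrow> ('a \<Rightarrow> 'a \<Rightarrow> 'a \<Rightarrow> real) \<Rightarrow> 'a endo \<Rightarrow>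
    'a::euclidean_space \<Rightarrow> 'a \<Rightarrow> 'a \<Rightarrow> real" where
  "H_of mu H G X Y Z = H X Y Z + d2 mu (snd (metric_b_field G)) X Y Z"

definition gen_ricci :: "('a \<Rightarrow> 'a \<Rightarrow> 'a) \<Rightarrow> ('a \<Rightarrow> 'a \<Rightarrow> 'a \<Rightarrow> real) \<Rightarrow> 'a endo \<Rightarrow>
    'a::euclidean_space endo" where
  "gen_ricci mu H G =
    (let g = fst (metric_b_field G); b = snd (metric_b_field G); HG = H_of mu H G;
         R = sharp_op g o\<^sub>L flat_op (\<lambda>X Y. ricci mu g X Y - square3 g HG X Y / 4);
         dH = flat_op (codiff3 mu g HG)
     in exp_b b
        o\<^sub>L block_op R ((1/2) *\<^sub>R (sharp_op g o\<^sub>L dH o\<^sub>L sharp_op g)) (- ((1/2) *\<^sub>R dH)) (- dual_op R)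
        o\<^sub>L exp_b (\<lambda>X Y. - b X Y))"

definition gen_scal :: "('a \<Rightarrow> 'a \<Rightarrow> 'a) \<Rightarrow> ('a \<Rightarrow> 'a \<Rightarrow> 'a \<Rightarrow> real) \<Rightarrow> 'a::euclidean_space endo \<Rightarrow> real" where
  "gen_scal mu H G = (let g = fst (metric_b_field G) in
     scal mu g - norm_sq3 g (H_of mu H G) / 12)"


subsection \<open>The gradient for the symmetric metric\<close>

definition endo_trace :: "'a::euclidean_space endo \<Rightarrow> real" where
  "endo_trace A = (\<Sum>i\<in>Basis. fst (A (i, 0)) \<bullet> i) +
     (\<Sum>i\<in>Basis. blinfun_apply (snd (A (0, blinfun_inner_left i))) i)"

definition sym_metric :: "'a::euclidean_space endo \<Rightarrow> 'a endo \<Rightarrow> real" where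
  "sym_metric A B = endo_trace (A o\<^sub>L B)"

definition gen_inner :: "'a::euclidean_space endo \<Rightarrow> 'a double \<Rightarrow> 'a double \<Rightarrow> real" where
  "gen_inner G u v = 2 * pairing (G u) v"

definition tangent_endos :: "'a::euclidean_space endo \<Rightarrow> 'a endo set" where
  "tangent_endos G = {A. (\<forall>u v. pairing (blinfun_apply A u) v + pairing u (A v) = 0) \<and>
     (\<forall>u v. gen_inner G (A u) v = gen_inner G u (A v))}"

text \<open>
  \<open>S\<close> is differentiable at \<open>G\<close> along the submanifold \<open>gen_metrics\<close> of the space of endomorphisms,
  and \<open>A\<close> is its gradient there. The endomorphism \<open>B\<close> stands for the tangent vector \<open>G B\<close>; a
  derivative \<open>D\<close> within \<open>gen_metrics\<close> is only determined on such vectors.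
\<close>

definition has_sym_gradient :: "('a::euclidean_space endo \<Rightarrow> real) \<Rightarrow> 'a endo \<Rightarrow> 'a endo \<Rightarrow> bool" where
  "has_sym_gradient S G A \<longleftrightarrow> A \<in> tangent_endos G \<and>
     (\<exists>D. (S has_derivative D) (at G within gen_metrics) \<and>
          (\<forall>B\<in>tangent_endos G. sym_metric A B = D (G o\<^sub>L B)))"

definition sym_grad :: "('a::euclidean_space endo \<Rightarrow> real) \<Rightarrow> 'a endo \<Rightarrow> 'a endo" where
  "sym_grad S G = (THE A. has_sym_gradient S G A)"

end

theory Submission
  imports Defs
begin

text \<open>
  A generalized metric is a pair of an inner product \<open>g\<close> and a 2-form \<open>b\<close>, and \<open>F = H + db\<close> is the
  3-form whose norm enters the generalized scalar curvature. The claim is the first variation formula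
  \<open>(scal(g) - |F|\<^sup>2/12)' = - \<langle>Ric - F\<^sup>2/4, h\<rangle> - \<langle>d\<^sup>* F, \<beta>\<rangle>/2\<close>
  for variations \<open>h\<close> of \<open>g\<close> and \<open>\<beta>\<close> of \<open>b\<close>, rewritten in terms of endomorphisms of the double.

  For the formula itself, the point is that the Lie group is unimodular. Left-invariant vector fields
  are then divergence-free (\<open>sum_nabla_divergence\<close>), which turns the Ricci tensor into a polynomial in
  \<open>g\<close>, its inverse and the bracket (\<open>ricci_formula\<close>) and makes the codifferential adjoint to the
  exterior derivative of invariant forms (\<open>codiff3_adjoint\<close>). In a frame that is orthonormal for the
  metric at the point of differentiation, both the scalar curvature and \<open>|F|\<^sup>2\<close> are contractions with
  the coefficients of the inverse metric. Differentiating these contractions reproduces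
  the Ricci formula term by term (\<open>scal_has_derivative\<close>) and \<open>F\<^sup>2\<close> and \<open>d\<^sup>* F\<close>
  (\<open>norm_sq3_has_derivative\<close>).

  For the translation, vectors of the double are written as \<open>e\<^sup>b (X + g Y)\<close>. The generalized metric \<open>G\<close>
  then exchanges \<open>X\<close> and \<open>Y\<close>. A tangent vector is a block matrix given by a symmetric \<open>P\<close> and a
  skew \<open>Q\<close> (\<open>tangent_endos_iff\<close>), it moves \<open>g\<close> by \<open>h = g P\<close> and \<open>b\<close> by \<open>\<beta> = g Q\<close>
  (\<open>dmetric_tangent\<close>, \<open>db_field_tangent\<close>), and the symmetric metric is twice the sum of the
  Hilbert--Schmidt products of the blocks (\<open>sym_metric_frame\<close>). The blocks of the generalized Ricci
  curvature are \<open>Ric - F\<^sup>2/4\<close> and \<open>d\<^sup>* F / 2\<close> (\<open>gen_ricci_blocks\<close>), so that comparing coefficients gives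
  the factor \<open>- 2\<close>.

  Two analytic points remain. The generalized scalar curvature is a function of the generalized
  metric, so \<open>g\<close> and \<open>b\<close> have to be differentiable functions of it; the inverse of \<open>g\<close> is a block of
  the generalized metric and inversion is treated by a resolvent identity
  (\<open>metric_of_has_derivative\<close>, \<open>b_of_has_derivative\<close>). And the gradient has to be unique, which needs
  curves of generalized metrics in every tangent direction (\<open>cayley_curve\<close>) and definiteness of the
  symmetric metric (\<open>sym_metric_definite\<close>).
\<close>

section \<open>Linear algebra of an inner product\<close>

lemma bilinear_linear:
  assumes "bilinear f"
  shows "linear (f x)" "linear (\<lambda>x. f x y)"
  using assms by (auto simp: bilinear_def)

lemmas bilin_simps = bilinear_ladd bilinear_radd bilinear_lmul bilinear_rmul
  bilinear_lneg bilinear_rneg bilinear_lsub bilinear_rsub bilinear_lzero bilinear_rzero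

lemma linear_sum_scaleR: "linear f \<Longrightarrow> f (\<Sum>i\<in>I. c i *\<^sub>R v i) = (\<Sum>i\<in>I. c i *\<^sub>R f (v i))"
  by (simp add: linear_sum linear_cmul)

lemma bilinear_sum_left: "bilinear f \<Longrightarrow> f (\<Sum>i\<in>I. c i *\<^sub>R v i) y = (\<Sum>i\<in>I. c i *\<^sub>R f (v i) y)"
  using linear_sum_scaleR[OF bilinear_linear(2)] by blast

lemma bilinear_sum_right: "bilinear f \<Longrightarrow> f x (\<Sum>i\<in>I. c i *\<^sub>R v i) = (\<Sum>i\<in>I. c i *\<^sub>R f x (v i))"
  using linear_sum_scaleR[OF bilinear_linear(1)] by blast

lemma bilinear_sum_fun: "(\<And>i. i \<in> I \<Longrightarrow> bilinear (f i)) \<Longrightarrow> bilinear (\<lambda>x y. \<Sum>i\<in>I. (f i x y :: real))"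
  unfolding bilinear_def by (auto intro!: linear_compose_sum)

lemma sum_mult_delta:
  fixes u :: "'a \<Rightarrow> real"
  assumes "finite E" "e \<in> E"
  shows "(\<Sum>a\<in>E. u a * (if a = e then 1 else 0)) = u e"
    "(\<Sum>a\<in>E. (if e = a then 1 else 0) * u a) = u e"
  using assms by (simp_all add: if_distrib[of "\<lambda>x. x * _"] if_distrib[of "\<lambda>x. _ * x"] cong: if_cong)

lemma two_form_skew: "two_form b \<Longrightarrow> b X Y = - b Y X"
  using bilinear_ladd[of b X Y "X + Y"] bilinear_radd[of b]
  by (simp add: two_form_def)

definition orthonormal_set :: "('a::euclidean_space \<Rightarrow> 'a \<Rightarrow> real) \<Rightarrow> 'a set \<Rightarrow> bool" where
  "orthonormal_set g E \<longleftrightarrow> finite E \<and> (\<forall>x\<in>E. \<forall>y\<in>E. g x y = (if x = y then 1 else 0))"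

lemma orthonormal_set_independent:
  assumes "bilinear g" "orthonormal_set g E"
  shows "independent E"
proof (rule independent_if_scalars_zero)
  show "finite E" using assms by (simp add: orthonormal_set_def)
  fix u e assume z: "(\<Sum>x\<in>E. u x *\<^sub>R x) = 0" and e: "e \<in> E"
  have "0 = g (\<Sum>x\<in>E. u x *\<^sub>R x) e" using z assms by (simp add: bilin_simps)
  also have "\<dots> = (\<Sum>x\<in>E. u x * (if x = e then 1 else 0))"
    using assms(2) e by (simp add: bilinear_sum_left[OF assms(1)] orthonormal_set_def)
  also have "\<dots> = u e" using assms e by (simp add: orthonormal_set_def sum_mult_delta)
  finally show "u e = 0" by simp
qed

text \<open>Gram--Schmidt in the form of a maximality argument: an orthonormal set that does not span
  can be enlarged by a normalised remainder of the orthogonal projection.\<close>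

lemma orthonormal_basis_exists:
  fixes g :: "'a::euclidean_space \<Rightarrow> 'a \<Rightarrow> real"
  assumes g: "inner_product g"
  shows "\<exists>E. orthonormal_basis g E"
proof -
  have g_bilinear: "bilinear g" and sym: "\<And>x y. g x y = g y x" and pos: "\<And>x. x \<noteq> 0 \<Longrightarrow> g x x > 0"
    using g by (auto simp: inner_product_def)
  let ?N = "{card E | E. orthonormal_set g E}"
  have "?N \<subseteq> {..DIM('a)}"
    using orthonormal_set_independent[OF g_bilinear] independent_bound by auto
  then have fin: "finite ?N" using finite_subset by blast
  have "orthonormal_set g {}" by (simp add: orthonormal_set_def)
  then have "?N \<noteq> {}" by blast
  then have "Max ?N \<in> ?N" using fin by (rule Max_in[rotated])
  then obtain E where E: "orthonormal_set g E" and Emax: "card E = Max ?N" by auto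
  have finE: "finite E" using E by (simp add: orthonormal_set_def)
  have "x \<in> span E" for x
  proof (rule ccontr)
    assume x: "x \<notin> span E"
    define y where "y = x - (\<Sum>e\<in>E. g x e *\<^sub>R e)"
    have "(\<Sum>e\<in>E. g x e *\<^sub>R e) \<in> span E" by (intro span_sum span_scale span_base)
    then have y: "y \<noteq> 0" using x by (auto simp: y_def)
    have perp: "g y e = 0" if "e \<in> E" for e
    proof -
      have "g (\<Sum>a\<in>E. g x a *\<^sub>R a) e = (\<Sum>a\<in>E. g x a * (if a = e then 1 else 0))"
        using E that by (simp add: bilinear_sum_left[OF g_bilinear] orthonormal_set_def)
      then show ?thesis using finE that by (simp add: y_def bilinear_lsub[OF g_bilinear] sum_mult_delta)
    qed
    define z where "z = (1 / sqrt (g y y)) *\<^sub>R y"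
    have zz: "g z z = 1" using pos[OF y]
      by (simp add: z_def bilinear_lmul[OF g_bilinear] bilinear_rmul[OF g_bilinear])
    have ze: "g z e = 0" if "e \<in> E" for e
      using perp[OF that] by (simp add: z_def bilinear_lmul[OF g_bilinear])
    have ez: "g e z = 0" if "e \<in> E" for e using ze[OF that] sym[of e z] by simp
    have "z \<notin> E" using ze zz by force
    have "orthonormal_set g (insert z E)"
      using E ze zz ez \<open>z \<notin> E\<close> by (auto simp: orthonormal_set_def)
    then have "card (insert z E) \<le> Max ?N" using fin by (intro Max_ge) auto
    then show False using \<open>z \<notin> E\<close> finE Emax by simp
  qed
  then have "orthonormal_basis g E"
    using E by (auto simp: orthonormal_basis_def orthonormal_set_def)
  then show ?thesis by blast
qed

locale metric =
  fixes g :: "'a::euclidean_space \<Rightarrow> 'a \<Rightarrow> real"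
  assumes inner: "inner_product g"
begin

abbreviation E :: "'a set" where "E \<equiv> onb g"

lemma g_bilinear: "bilinear g" and sym: "g x y = g y x" and pos: "x \<noteq> 0 \<Longrightarrow> g x x > 0"
  using inner by (auto simp: inner_product_def)

lemma onb: "orthonormal_basis g E"
  unfolding onb_def by (rule someI_ex) (rule orthonormal_basis_exists[OF inner])

lemma fin: "finite E" and spanE: "span E = UNIV"
  and ortho: "e \<in> E \<Longrightarrow> f \<in> E \<Longrightarrow> g e f = (if e = f then 1 else 0)"
  using onb by (auto simp: orthonormal_basis_def)

lemmas g_simps = bilin_simps[OF g_bilinear]

lemma nonneg: "g x x \<ge> 0"
  using pos[of x] by (cases "x = 0") (auto simp: g_simps)

lemma expand: "X = (\<Sum>e\<in>E. g X e *\<^sub>R e)"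
proof -
  have "X \<in> span E" using spanE by simp
  then obtain u where u: "X = (\<Sum>e\<in>E. u e *\<^sub>R e)" using span_finite[OF fin] by auto
  have "g X e = u e" if "e \<in> E" for e
  proof -
    have "g X e = (\<Sum>a\<in>E. u a * g a e)" unfolding u by (simp add: bilinear_sum_left[OF g_bilinear])
    also have "\<dots> = (\<Sum>a\<in>E. u a * (if a = e then 1 else 0))"
      by (intro sum.cong refl) (simp add: ortho that)
    finally show ?thesis using that fin by (simp add: sum_mult_delta)
  qed
  then have "(\<Sum>e\<in>E. g X e *\<^sub>R e) = (\<Sum>e\<in>E. u e *\<^sub>R e)" by (intro sum.cong refl) simp
  then show ?thesis using u by simp
qed

lemma expand_linear:
  fixes f :: "'a \<Rightarrow> 'b::real_vector"
  assumes "linear f" shows "f X = (\<Sum>e\<in>E. g X e *\<^sub>R f e)"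
  using linear_sum_scaleR[OF assms, of "g X" "\<lambda>e. e" E] expand[of X] by simp

lemma parseval: "g X Y = (\<Sum>e\<in>E. g X e * g Y e)"
  using expand_linear[OF bilinear_linear(2)[OF g_bilinear], of X Y] by (simp add: sym[of _ Y])

lemma eqI: "(\<And>Z. g X Z = g Y Z) \<Longrightarrow> X = Y"
  using pos[of "X - Y"] by (fastforce simp: g_simps)

lemma lin_trace_onb:
  assumes "linear f" shows "lin_trace f = (\<Sum>e\<in>E. g (f e) e)"
proof -
  have "lin_trace f = (\<Sum>i\<in>Basis. \<Sum>e\<in>E. g i e * (f e \<bullet> i))"
    unfolding lin_trace_def
    by (intro sum.cong refl) (subst expand_linear[OF assms], simp add: inner_sum_left)
  also have "\<dots> = (\<Sum>e\<in>E. \<Sum>i\<in>Basis. (f e \<bullet> i) *\<^sub>R g i e)"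
    by (subst sum.swap) (simp add: mult.commute)
  also have "\<dots> = (\<Sum>e\<in>E. g (f e) e)"
    by (intro sum.cong refl)
      (subst bilinear_sum_left[OF g_bilinear, symmetric], simp add: euclidean_representation)
  finally show ?thesis .
qed

lemma trace_commute:
  assumes "linear f" "linear h"
  shows "(\<Sum>e\<in>E. g (f (h e)) e) = (\<Sum>e\<in>E. g (h (f e)) e)"
proof -
  have 1: "(\<Sum>e\<in>E. g (f (h e)) e) = (\<Sum>e\<in>E. \<Sum>a\<in>E. g (h e) a * g (f a) e)"
    if "linear f" "linear h" for f h
    by (intro sum.cong refl, subst expand_linear[OF that(1)])
      (simp add: bilinear_sum_left[OF g_bilinear])
  show ?thesis unfolding 1[OF assms] 1[OF assms(2,1)]
    by (subst sum.swap) (simp add: mult.commute)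
qed

end

lemma blinfun_apply_linear:
  fixes f :: "'a::euclidean_space \<Rightarrow> 'b::real_normed_vector"
  shows "linear f \<Longrightarrow> blinfun_apply (Blinfun f) = f"
  by (intro bounded_linear_Blinfun_apply) (simp add: linear_conv_bounded_linear)

lemma flat_op_apply:
  assumes "bilinear f" shows "blinfun_apply (flat_op f X) Y = f X Y"
proof -
  have "linear (\<lambda>X. Blinfun (f X))"
  proof (intro linearI blinfun_eqI)
    show "blinfun_apply (Blinfun (f (x + y))) i = blinfun_apply (Blinfun (f x) + Blinfun (f y)) i" for x y i
      using bilinear_linear[OF assms]
      by (simp add: blinfun.add_left blinfun_apply_linear bilinear_ladd[OF assms])
    show "blinfun_apply (Blinfun (f (r *\<^sub>R x))) i = blinfun_apply (r *\<^sub>R Blinfun (f x)) i" for r x i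
      using bilinear_linear[OF assms]
      by (simp add: blinfun.scaleR_left blinfun_apply_linear bilinear_lmul[OF assms])
  qed
  then show ?thesis
    using bilinear_linear[OF assms] by (simp add: flat_op_def blinfun_apply_linear)
qed

context metric begin

text \<open>The covector \<open>\<xi>\<close> is \<open>g Y\<close> for \<open>Y = \<Sum> \<xi>(e) e\<close>; this makes the inverse of \<open>flat_op g\<close> explicit,
  so that \<open>sharp_op\<close> is the intended bounded operator and not an unspecified value of \<open>Blinfun\<close>.\<close>

lemma riesz: "\<xi> = flat_op g (\<Sum>e\<in>E. blinfun_apply \<xi> e *\<^sub>R e)"
proof (rule blinfun_eqI)
  fix Y
  have "\<xi> Y = (\<Sum>e\<in>E. g Y e *\<^sub>R \<xi> e)" by (rule expand_linear) (rule bounded_linear.linear[OF blinfun.bounded_linear_right])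
  then show "\<xi> Y = flat_op g (\<Sum>e\<in>E. blinfun_apply \<xi> e *\<^sub>R e) Y"
    by (simp add: flat_op_apply[OF g_bilinear] bilinear_sum_left[OF g_bilinear] sym[of Y] mult.commute)
qed

lemma flat_bij: "bij (blinfun_apply (flat_op g))"
  unfolding bij_def
proof
  show "inj (flat_op g)"
    by (rule injI, rule eqI, subst (1 2) flat_op_apply[OF g_bilinear, symmetric]) simp
  show "surj (flat_op g)" by (rule surjI) (rule riesz[symmetric])
qed

lemma sharp_apply: "blinfun_apply (sharp_op g) \<xi> = (\<Sum>e\<in>E. blinfun_apply \<xi> e *\<^sub>R e)"
proof -
  have "inv (flat_op g) = (\<lambda>\<xi>. \<Sum>e\<in>E. blinfun_apply \<xi> e *\<^sub>R e)"
    by (rule ext, rule inv_f_eq[OF bij_is_inj[OF flat_bij]]) (rule riesz[symmetric])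
  moreover have "bounded_linear (\<lambda>\<xi>. \<Sum>e\<in>E. blinfun_apply (\<xi> :: 'a dual) e *\<^sub>R e)"
    by (intro bounded_linear_intros)
  ultimately show ?thesis by (simp add: sharp_op_def bounded_linear_Blinfun_apply)
qed

lemma flat_sharp [simp]: "blinfun_apply (flat_op g) (sharp_op g \<xi>) = \<xi>"
  using riesz[of \<xi>] by (simp add: sharp_apply)

lemma sharp_flat [simp]: "blinfun_apply (sharp_op g) (flat_op g X) = X"
  by (rule injD[OF bij_is_inj[OF flat_bij]]) simp

lemma g_sharp: "g (sharp_op g \<xi>) Y = blinfun_apply \<xi> Y"
  by (subst flat_op_apply[OF g_bilinear, symmetric]) simp

text \<open>The inverse metric of \<open>g'\<close>, written in a frame that is orthonormal for \<open>g\<close>, contracts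
  bilinear expressions in the same way as a \<open>g'\<close>-orthonormal frame does.\<close>

lemma inverse_metric_contraction:
  assumes g': "metric g'" and f: "bilinear f"
  shows "(\<Sum>e\<in>onb g'. f e e) =
    (\<Sum>a\<in>E. \<Sum>l\<in>E. g a (sharp_op g' (flat_op g l)) * (f a l :: real))"
proof -
  have k: "(\<Sum>e\<in>onb g'. g e a * g e l) = g a (sharp_op g' (flat_op g l))" for a l
  proof -
    have "g e l = g' (sharp_op g' (flat_op g l)) e" for e
      by (simp add: metric.g_sharp[OF g'] flat_op_apply[OF g_bilinear] sym)
    then show ?thesis
      using metric.expand_linear[OF g' bilinear_linear(1)[OF g_bilinear], of a "sharp_op g' (flat_op g l)"]
      by (simp add: sym mult.commute)
  qed
  have "(\<Sum>e\<in>onb g'. f e e) = (\<Sum>e\<in>onb g'. \<Sum>a\<in>E. \<Sum>l\<in>E. g e a * g e l * f a l)"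
  proof (intro sum.cong refl)
    fix e
    have "f e e = (\<Sum>a\<in>E. g e a *\<^sub>R f a e)" by (rule expand_linear[OF bilinear_linear(2)[OF f]])
    also have "\<dots> = (\<Sum>a\<in>E. g e a *\<^sub>R (\<Sum>l\<in>E. g e l *\<^sub>R f a l))"
      by (intro sum.cong refl arg_cong2[of _ _ _ _ scaleR] expand_linear bilinear_linear(1)[OF f])
    finally show "f e e = (\<Sum>a\<in>E. \<Sum>l\<in>E. g e a * g e l * f a l)"
      by (simp add: sum_distrib_left mult.assoc)
  qed
  also have "\<dots> = (\<Sum>a\<in>E. \<Sum>l\<in>E. (\<Sum>e\<in>onb g'. g e a * g e l) * f a l)"
    by (subst sum.swap, rule sum.cong[OF refl], subst sum.swap) (simp add: sum_distrib_right)
  finally show ?thesis by (simp add: k)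
qed

end

section \<open>The Levi-Civita connection of a left-invariant metric\<close>

text \<open>Full contractions of an array see only its symmetric part. The index manipulations behind the
  Ricci and codifferential formulas become pointwise identities in this way.\<close>

lemma sum_symmetrize:
  fixes F G :: "'b \<Rightarrow> 'b \<Rightarrow> real"
  assumes "\<And>i j. i \<in> I \<Longrightarrow> j \<in> I \<Longrightarrow> F i j + F j i = G i j + G j i"
  shows "(\<Sum>i\<in>I. \<Sum>j\<in>I. F i j) = (\<Sum>i\<in>I. \<Sum>j\<in>I. G i j)"
proof -
  have "(\<Sum>i\<in>I. \<Sum>j\<in>I. F i j + F j i) = (\<Sum>i\<in>I. \<Sum>j\<in>I. G i j + G j i)"
    using assms by (intro sum.cong refl) auto
  moreover have "(\<Sum>i\<in>I. \<Sum>j\<in>I. F j i) = (\<Sum>i\<in>I. \<Sum>j\<in>I. F i j)"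
    "(\<Sum>i\<in>I. \<Sum>j\<in>I. G j i) = (\<Sum>i\<in>I. \<Sum>j\<in>I. G i j)"
    by (rule sum.swap)+
  ultimately show ?thesis by (simp add: sum.distrib)
qed

lemma three_form_multilinear:
  assumes "three_form H"
  shows "bilinear (H X)" "bilinear (\<lambda>X Y. H X Y Z)" "bilinear (\<lambda>X Z. H X Y Z)"
    "linear (\<lambda>X. H X Y Z)"
  using assms by (auto simp: three_form_def bilinear_def)

lemma three_form_skew:
  assumes "three_form H"
  shows "H X Y Z = - H Y X Z" "H X Y Z = - H X Z Y"
proof -
  have "two_form (\<lambda>X Y. H X Y Z)" "two_form (H X)"
    using assms three_form_multilinear[OF assms] by (auto simp: two_form_def three_form_def)
  then show "H X Y Z = - H Y X Z" "H X Y Z = - H X Z Y"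
    using two_form_skew by blast+
qed

locale left_invariant_metric = metric g
  for g :: "'a::euclidean_space \<Rightarrow> 'a \<Rightarrow> real" +
  fixes mu :: "'a \<Rightarrow> 'a \<Rightarrow> 'a"
  assumes mu: "bilinear mu" and mu_alt: "mu X X = 0"
begin

lemmas mu_simps = bilin_simps[OF mu]

lemma mu_skew: "mu X Y = - mu Y X"
proof -
  have "mu X Y + mu Y X = mu (X + Y) (X + Y)" by (simp only: mu_simps) (simp add: mu_alt)
  then have "mu X Y + mu Y X = 0" by (simp add: mu_alt)
  then show ?thesis by (simp add: eq_neg_iff_add_eq_0)
qed

text \<open>The Koszul expression \<open>g(\<nabla>\<^sub>X Y, Z)\<close>; the terms that differentiate \<open>g\<close> vanish by
  left-invariance. Reading it off in an orthonormal frame gives the connection.\<close>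

definition koszul :: "'a \<Rightarrow> 'a \<Rightarrow> 'a \<Rightarrow> real" where
  "koszul X Y Z = (g (mu X Y) Z - g (mu Y Z) X + g (mu Z X) Y) / 2"

definition nabla :: "'a \<Rightarrow> 'a \<Rightarrow> 'a" where
  "nabla X Y = (\<Sum>e\<in>E. koszul X Y e *\<^sub>R e)"

lemma koszul_linear: "linear (koszul X Y)" "bilinear (\<lambda>X Y. koszul X Y Z)"
  unfolding koszul_def bilinear_def
  by (auto intro!: linearI simp: g_simps mu_simps field_simps)

lemma g_nabla: "g (nabla X Y) Z = koszul X Y Z"
  unfolding nabla_def bilinear_sum_left[OF g_bilinear]
  by (subst expand_linear[OF koszul_linear(1)[of X Y]]) (simp add: sym[of _ Z] mult.commute)

lemma nabla_bilinear: "bilinear nabla"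
  unfolding bilinear_def
  by (intro conjI allI linearI; rule eqI)
     (simp_all add: g_simps g_nabla bilin_simps[OF koszul_linear(2)])

text \<open>Substituting torsion-freeness into the three bracket terms of the Koszul expression, metric
  compatibility cancels everything except twice \<open>g (D X Y) Z\<close>.\<close>

lemma nabla_unique:
  assumes "\<And>X Y. D X Y - D Y X = mu X Y" and m: "\<And>X Y Z. g (D X Y) Z + g Y (D X Z) = 0"
  shows "D = nabla"
proof (intro ext eqI)
  fix X Y Z
  have t: "g (mu X Y) Z = g (D X Y) Z - g (D Y X) Z" for X Y Z
    by (simp add: assms(1)[symmetric] g_simps)
  show "g (D X Y) Z = g (nabla X Y) Z"
    using m[of X Y Z] m[of Y X Z] m[of Z Y X] unfolding g_nabla koszul_def t
    by (simp add: sym[of Y "D X Z"] sym[of X "D Y Z"] sym[of X "D Z Y"] sym[of Z "D Y X"]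
      sym[of Z "D X Y"] sym[of Y "D Z X"] field_simps)
qed

lemma nabla_torsion: "nabla X Y = nabla Y X + mu X Y"
proof (rule eqI)
  fix Z
  show "g (nabla X Y) Z = g (nabla Y X + mu X Y) Z"
    using mu_skew[of Y X] mu_skew[of Y Z] mu_skew[of X Z]
    by (simp add: g_simps g_nabla koszul_def field_simps)
qed

lemma nabla_metric: "g (nabla X Y) Z = - g Y (nabla X Z)"
  using mu_skew[of X Z] mu_skew[of Z Y] mu_skew[of X Y]
  by (simp add: sym[of Y "nabla X Z"] g_nabla koszul_def g_simps field_simps)

lemma levi_civita_eq: "levi_civita mu g = nabla"
  unfolding levi_civita_def
proof (rule the_equality)
  have "nabla X Y - nabla Y X = mu X Y" for X Y by (simp add: nabla_torsion[of X Y])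
  moreover have "g (nabla X Y) Z + g Y (nabla X Z) = 0" for X Y Z
    by (simp add: nabla_metric[of X Y Z])
  ultimately show "bilinear nabla \<and> (\<forall>X Y. nabla X Y - nabla Y X = mu X Y) \<and>
      (\<forall>X Y Z. g (nabla X Y) Z + g Y (nabla X Z) = 0)"
    using nabla_bilinear by blast
next
  fix D assume "bilinear D \<and> (\<forall>X Y. D X Y - D Y X = mu X Y) \<and>
      (\<forall>X Y Z. g (D X Y) Z + g Y (D X Z) = 0)"
  then show "D = nabla" by (intro nabla_unique) auto
qed

lemmas nabla_simps = bilin_simps[OF nabla_bilinear]

lemma koszul_self: "koszul e Z e = - g (mu Z e) e"
  using mu_skew[of e Z] by (simp add: koszul_def mu_alt g_simps)

end

locale unimodular_metric = left_invariant_metric +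
  assumes unimod: "unimodular mu"
begin

text \<open>The divergence of a left-invariant field \<open>Z\<close> is \<open>- tr (ad Z)\<close>. This is where unimodularity
  enters: all divergence terms in the Ricci tensor and in the codifferential drop out.\<close>

lemma sum_nabla_divergence: "(\<Sum>e\<in>E. g (nabla e Z) e) = 0"
proof -
  have "(\<Sum>e\<in>E. g (nabla e Z) e) = - lin_trace (mu Z)"
    by (simp add: lin_trace_onb bilinear_linear[OF mu] g_nabla koszul_self sum_negf)
  then show ?thesis using unimod by (simp add: unimodular_def)
qed

lemma sum_nabla_diag: "(\<Sum>e\<in>E. nabla e e) = 0"
proof (rule eqI)
  fix Z
  have "g (\<Sum>e\<in>E. nabla e e) Z = (\<Sum>e\<in>E. g (nabla e e) Z)"
    using bilinear_sum_left[OF g_bilinear, of "\<lambda>_. 1"] by simp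
  also have "\<dots> = - (\<Sum>e\<in>E. g (nabla e Z) e)"
    by (subst nabla_metric) (simp add: sym sum_negf)
  finally show "g (\<Sum>e\<in>E. nabla e e) Z = g 0 Z" by (simp add: sum_nabla_divergence g_simps)
qed

text \<open>After the divergence term has dropped out, the Ricci tensor is quadratic in the numbers
  \<open>g(\<nabla>\<^sub>i Y, j)\<close>. Writing these by the Koszul expression in terms of \<open>y i j = g [i,Y] j\<close>,
  \<open>z i j = g [i,Z] j\<close> and \<open>g [i,j] Y\<close>, \<open>g [i,j] Z\<close>, the symmetric and skew parts separate.
  Here \<open>ricci\<close> appears as a polynomial in \<open>g\<close> and its inverse, which makes it possible to
  differentiate its trace in \<open>g\<close>.\<close>

lemma ricci_formula:
  "ricci mu g Y Z = (\<Sum>i\<in>E. \<Sum>j\<in>E. g (mu i j) Y * g (mu i j) Z) / 4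
     - (\<Sum>i\<in>E. g (mu i Y) (mu i Z)) / 2 - lin_trace (\<lambda>X. mu Y (mu Z X)) / 2"
proof -
  define y where "y i j = g (mu i Y) j" for i j
  define z where "z i j = g (mu i Z) j" for i j
  have lin: "linear (\<lambda>X. curvature mu g X Y Z)"
    unfolding curvature_def levi_civita_eq Let_def
    by (intro linearI) (simp_all add: nabla_simps mu_simps algebra_simps)
  have k: "koszul i W j = (g (mu i W) j + g (mu j W) i - g (mu i j) W) / 2" for i j W
    using mu_skew[of W j] mu_skew[of j i] by (simp add: koszul_def g_simps)
  have "ricci mu g Y Z = (\<Sum>e\<in>E. g (curvature mu g e Y Z) e)"
    unfolding ricci_def by (rule lin_trace_onb[OF lin])
  also have "\<dots> = (\<Sum>e\<in>E. g (nabla e Z) (nabla e Y) + g (nabla e Z) (mu Y e)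
      - g (nabla (mu e Y) Z) e)"
  proof -
    have "g (curvature mu g e Y Z) e = g (nabla e (nabla Y Z)) e
      + (g (nabla e Z) (nabla e Y) + g (nabla e Z) (mu Y e) - g (nabla (mu e Y) Z) e)" for e
      unfolding curvature_def levi_civita_eq Let_def
      by (simp add: g_simps nabla_metric[of Y "nabla e Z"] nabla_torsion[of Y e])
    then show ?thesis by (simp add: sum.distrib sum_nabla_divergence)
  qed
  also have "\<dots> = (\<Sum>i\<in>E. \<Sum>j\<in>E. koszul i Z j * koszul i Y j
      - koszul i Z j * y i j - y i j * koszul j Z i)"
  proof (rule sum.cong[OF refl])
    fix i
    have "g (nabla (mu i Y) Z) i = (\<Sum>j\<in>E. y i j * koszul j Z i)"
      using expand_linear[of "\<lambda>W. g (nabla W Z) i" "mu i Y"] bilinear_linear(2)[OF koszul_linear(2)]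
      by (simp add: g_nabla y_def)
    moreover have "g (nabla i Z) (mu Y i) = - (\<Sum>j\<in>E. koszul i Z j * y i j)"
      by (subst parseval) (simp add: g_nabla mu_skew[of Y i] g_simps sum_negf y_def)
    moreover have "g (nabla i Z) (nabla i Y) = (\<Sum>j\<in>E. koszul i Z j * koszul i Y j)"
      by (subst parseval) (simp add: g_nabla)
    ultimately show "g (nabla i Z) (nabla i Y) + g (nabla i Z) (mu Y i) - g (nabla (mu i Y) Z) i
      = (\<Sum>j\<in>E. koszul i Z j * koszul i Y j - koszul i Z j * y i j - y i j * koszul j Z i)"
      by (simp add: sum_subtractf)
  qed
  also have "\<dots> = (\<Sum>i\<in>E. \<Sum>j\<in>E. g (mu i j) Y * g (mu i j) Z / 4 - y i j * z i j / 2 - y i j * z j i / 2)"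
  proof (rule sum_symmetrize)
    fix i j
    have s: "g (mu j i) W = - g (mu i j) W" for W by (subst mu_skew) (simp add: g_simps)
    show "koszul i Z j * koszul i Y j - koszul i Z j * y i j - y i j * koszul j Z i +
        (koszul j Z i * koszul j Y i - koszul j Z i * y j i - y j i * koszul i Z j) =
        g (mu i j) Y * g (mu i j) Z / 4 - y i j * z i j / 2 - y i j * z j i / 2 +
        (g (mu j i) Y * g (mu j i) Z / 4 - y j i * z j i / 2 - y j i * z i j / 2)"
      unfolding k s y_def z_def by (simp add: field_simps)
  qed
  also have "\<dots> = (\<Sum>i\<in>E. \<Sum>j\<in>E. g (mu i j) Y * g (mu i j) Z) / 4
     - (\<Sum>i\<in>E. g (mu i Y) (mu i Z)) / 2 - lin_trace (\<lambda>X. mu Y (mu Z X)) / 2"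
  proof -
    have "linear (\<lambda>X. mu Y (mu Z X))" by (intro linearI) (simp_all add: mu_simps)
    then have "lin_trace (\<lambda>X. mu Y (mu Z X)) = (\<Sum>i\<in>E. g (mu Y (mu Z i)) i)"
      by (rule lin_trace_onb)
    also have "\<dots> = (\<Sum>i\<in>E. \<Sum>j\<in>E. z i j * y j i)"
    proof (rule sum.cong[OF refl])
      fix i
      have "linear (\<lambda>W. g (mu Y W) i)" by (intro linearI) (simp_all add: mu_simps g_simps)
      from expand_linear[OF this, of "mu Z i"] show "g (mu Y (mu Z i)) i = (\<Sum>j\<in>E. z i j * y j i)"
        by (simp add: mu_skew[of Z] mu_skew[of Y] g_simps z_def y_def sum_negf)
    qed
    also have "\<dots> = (\<Sum>i\<in>E. \<Sum>j\<in>E. y i j * z j i)"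
      by (subst sum.swap) (simp add: mult.commute)
    finally have "lin_trace (\<lambda>X. mu Y (mu Z X)) = (\<Sum>i\<in>E. \<Sum>j\<in>E. y i j * z j i)" .
    moreover have "g (mu i Y) (mu i Z) = (\<Sum>j\<in>E. y i j * z i j)" for i
      by (subst parseval) (simp add: y_def z_def)
    ultimately show ?thesis by (simp add: sum_subtractf sum_divide_distrib)
  qed
  finally show ?thesis .
qed

lemma ricci_bilinear: "bilinear (ricci mu g)"
proof -
  have t: "lin_trace (\<lambda>X. mu Y (mu Z X)) = (\<Sum>i\<in>Basis. mu Y (mu Z i) \<bullet> i)" for Y Z
    by (simp add: lin_trace_def)
  show ?thesis
    unfolding bilinear_def ricci_formula t
    by (intro conjI allI linearI)
      (simp_all add: g_simps mu_simps inner_add_left sum.distrib sum_distrib_left algebra_simps add_divide_distrib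
        sum_divide_distrib)
qed

text \<open>Visible from the explicit formula: the only term that is not manifestly symmetric is the
  Killing form.\<close>

lemma ricci_sym: "ricci mu g Y Z = ricci mu g Z Y"
proof -
  have "lin_trace (\<lambda>X. mu Y (mu Z X)) = lin_trace (\<lambda>X. mu Z (mu Y X))"
    using trace_commute[of "mu Y" "mu Z"] bilinear_linear(1)[OF mu]
    by (simp add: lin_trace_onb linear_compose[unfolded o_def, of "mu _" "mu _"])
  then show ?thesis unfolding ricci_formula by (simp add: sym mult.commute)
qed

lemma scal_formula:
  "scal mu g = - (\<Sum>i\<in>E. \<Sum>j\<in>E. g (mu i j) (mu i j)) / 4
     - (\<Sum>i\<in>E. lin_trace (\<lambda>X. mu i (mu i X))) / 2"
proof -
  have "(\<Sum>e\<in>E. \<Sum>i\<in>E. \<Sum>j\<in>E. g (mu i j) e * g (mu i j) e) = (\<Sum>i\<in>E. \<Sum>j\<in>E. g (mu i j) (mu i j))"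
    by (subst sum.swap, rule sum.cong[OF refl], subst sum.swap) (simp add: parseval[symmetric])
  moreover have "(\<Sum>e\<in>E. \<Sum>i\<in>E. g (mu i e) (mu i e)) = (\<Sum>i\<in>E. \<Sum>j\<in>E. g (mu i j) (mu i j))"
    by (rule sum.swap)
  ultimately show ?thesis
    unfolding scal_def ricci_formula
    by (simp add: sum_subtractf sum_divide_distrib[symmetric])
qed

lemma codiff3_formula:
  assumes H: "three_form H"
  shows "codiff3 mu g H X Y = (\<Sum>e\<in>E. H e (nabla e X) Y + H e X (nabla e Y))"
proof -
  have "(\<Sum>e\<in>E. H (nabla e e) X Y) = H (\<Sum>e\<in>E. nabla e e) X Y"
    by (simp add: linear_sum[OF three_form_multilinear(4)[OF H]])
  also have "\<dots> = 0"
    by (simp add: sum_nabla_diag linear_0[OF three_form_multilinear(4)[OF H]])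
  finally show ?thesis
    unfolding codiff3_def nabla3_def levi_civita_eq Let_def
    by (simp add: sum_subtractf sum_negf sum.distrib)
qed

lemma codiff3_two_form:
  assumes H: "three_form H"
  shows "two_form (codiff3 mu g H)"
proof -
  note Hs = bilin_simps[OF three_form_multilinear(1)[OF H]]
  have "H e X (nabla e X) = - H e (nabla e X) X" for e X by (rule three_form_skew(2)[OF H])
  moreover have "bilinear (codiff3 mu g H)"
    unfolding bilinear_def codiff3_formula[OF H]
    by (intro conjI allI linearI)
      (simp_all add: Hs nabla_simps sum.distrib sum_distrib_left algebra_simps)
  ultimately show ?thesis by (simp add: two_form_def codiff3_formula[OF H])
qed

text \<open>The codifferential is adjoint to \<open>d2\<close>. The factor 3 is the ratio \<open>3!/2!\<close> between the tensor
  inner products used here and the inner products of differential forms. Both sides equal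
  \<open>- 3 T\<close> with \<open>T = \<Sum> H i j k b([i,j],k)\<close>: the left one since its three summands agree after renaming indices,
  the right one since skewness of \<open>H\<close> antisymmetrizes the connection, whose antisymmetric part is
  the bracket.\<close>

lemma codiff3_adjoint:
  assumes H: "three_form H" and b: "two_form b"
  shows "(\<Sum>i\<in>E. \<Sum>j\<in>E. \<Sum>k\<in>E. H i j k * d2 mu b i j k) =
    3 * (\<Sum>i\<in>E. \<Sum>j\<in>E. codiff3 mu g H i j * b i j)"
proof -
  note Hml = three_form_multilinear[OF H] and Hsk = three_form_skew[OF H]
  have b_bilinear: "bilinear b" using b by (simp add: two_form_def)
  define T where "T = (\<Sum>i\<in>E. \<Sum>j\<in>E. \<Sum>k\<in>E. H i j k * b (mu i j) k)"
  have "(\<Sum>i\<in>E. \<Sum>j\<in>E. \<Sum>k\<in>E. H i j k * b (mu i k) j) = (\<Sum>i\<in>E. \<Sum>j\<in>E. \<Sum>k\<in>E. H i k j * b (mu i j) k)"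
    by (rule sum.cong[OF refl], rule sum.swap)
  also have "\<dots> = - T" unfolding T_def
    by (subst Hsk(2)) (simp add: sum_negf)
  finally have 2: "(\<Sum>i\<in>E. \<Sum>j\<in>E. \<Sum>k\<in>E. H i j k * b (mu i k) j) = - T" .
  have "(\<Sum>i\<in>E. \<Sum>j\<in>E. \<Sum>k\<in>E. H i j k * b (mu j k) i) = (\<Sum>j\<in>E. \<Sum>i\<in>E. \<Sum>k\<in>E. H i j k * b (mu j k) i)"
    by (rule sum.swap)
  also have "\<dots> = (\<Sum>j\<in>E. \<Sum>k\<in>E. \<Sum>i\<in>E. H i j k * b (mu j k) i)"
    by (rule sum.cong[OF refl], rule sum.swap)
  also have "\<dots> = T" unfolding T_def
    by (intro sum.cong refl) (metis Hsk minus_minus)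
  finally have 3: "(\<Sum>i\<in>E. \<Sum>j\<in>E. \<Sum>k\<in>E. H i j k * b (mu j k) i) = T" .
  have L: "(\<Sum>i\<in>E. \<Sum>j\<in>E. \<Sum>k\<in>E. H i j k * d2 mu b i j k) = - 3 * T"
    using 2 3 by (simp add: d2_def algebra_simps sum.distrib sum_subtractf sum_negf T_def[symmetric])
  \<comment> \<open>Only the part of the connection that is skew in \<open>e\<close> and \<open>l\<close> survives the contraction with \<open>H\<close>.\<close>
  have 4: "(\<Sum>e\<in>E. H e (nabla e j) k) = - (\<Sum>e\<in>E. \<Sum>l\<in>E. g (mu e l) j * H e l k) / 2" for j k
  proof -
    have "H e (nabla e j) k = (\<Sum>l\<in>E. koszul e j l * H e l k)" for e
      using expand_linear[OF bilinear_linear(2)[OF Hml(1)], of e "nabla e j" k] by (simp add: g_nabla)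
    then have "(\<Sum>e\<in>E. H e (nabla e j) k) = (\<Sum>e\<in>E. \<Sum>l\<in>E. koszul e j l * H e l k)" by simp
    also have "\<dots> = (\<Sum>e\<in>E. \<Sum>l\<in>E. - (g (mu e l) j * H e l k) / 2)"
    proof (rule sum_symmetrize)
      fix e l
      have "H l e k = - H e l k" by (rule Hsk(1))
      then show "koszul e j l * H e l k + koszul l j e * H l e k =
        - (g (mu e l) j * H e l k) / 2 + - (g (mu l e) j * H l e k) / 2"
        using mu_skew[of j l] mu_skew[of l e] mu_skew[of j e]
        by (simp add: koszul_def g_simps field_simps)
    qed
    finally show ?thesis by (simp add: sum_negf sum_divide_distrib)
  qed
  have "(\<Sum>i\<in>E. \<Sum>j\<in>E. codiff3 mu g H i j * b i j) =
      (\<Sum>i\<in>E. \<Sum>j\<in>E. 2 * (\<Sum>e\<in>E. H e (nabla e i) j) * b i j)"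
  proof (rule sum_symmetrize)
    fix i j
    have "b j i = - b i j" by (rule two_form_skew[OF b])
    moreover have "H e i (nabla e j) = - H e (nabla e j) i" for i j e by (rule Hsk(2))
    ultimately show "codiff3 mu g H i j * b i j + codiff3 mu g H j i * b j i =
      2 * (\<Sum>e\<in>E. H e (nabla e i) j) * b i j + 2 * (\<Sum>e\<in>E. H e (nabla e j) i) * b j i"
      by (simp add: codiff3_formula[OF H] sum_subtractf algebra_simps)
  qed
  also have "\<dots> = - (\<Sum>i\<in>E. \<Sum>j\<in>E. \<Sum>e\<in>E. \<Sum>l\<in>E. g (mu e l) i * H e l j * b i j)"
    by (simp add: 4 sum_negf sum_distrib_right)
  also have "\<dots> = - T"
  proof -
    have "(\<Sum>i\<in>E. \<Sum>j\<in>E. \<Sum>e\<in>E. \<Sum>l\<in>E. g (mu e l) i * H e l j * b i j) =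
        (\<Sum>e\<in>E. \<Sum>l\<in>E. \<Sum>j\<in>E. \<Sum>i\<in>E. g (mu e l) i * H e l j * b i j)"
      (is "?a = ?b")
    proof -
      have "?a = (\<Sum>j\<in>E. \<Sum>i\<in>E. \<Sum>e\<in>E. \<Sum>l\<in>E. g (mu e l) i * H e l j * b i j)" by (rule sum.swap)
      also have "\<dots> = (\<Sum>j\<in>E. \<Sum>e\<in>E. \<Sum>l\<in>E. \<Sum>i\<in>E. g (mu e l) i * H e l j * b i j)"
        by (rule sum.cong[OF refl], subst sum.swap, rule sum.cong[OF refl], rule sum.swap)
      also have "\<dots> = ?b"
        by (subst sum.swap, rule sum.cong[OF refl], rule sum.swap)
      finally show ?thesis .
    qed
    also have "\<dots> = T" unfolding T_def
    proof (intro sum.cong refl)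
      fix e l j
      have "b (mu e l) j = (\<Sum>i\<in>E. g (mu e l) i * b i j)"
        using expand_linear[OF bilinear_linear(2)[OF b_bilinear], of "mu e l" j] by simp
      then show "(\<Sum>i\<in>E. g (mu e l) i * H e l j * b i j) = H e l j * b (mu e l) j"
        by (simp add: sum_distrib_left mult_ac)
    qed
    finally show ?thesis by simp
  qed
  finally show ?thesis using L by simp
qed

end

lemma d2_three_form:
  assumes mu: "bilinear mu" "\<And>X. mu X X = 0" and b: "two_form b"
  shows "three_form (d2 mu b)"
proof -
  have b_bilinear: "bilinear b" and b0: "\<And>X. b X X = 0" using b by (auto simp: two_form_def)
  note s = bilin_simps[OF mu(1)] bilin_simps[OF b_bilinear]
  show ?thesis
    unfolding three_form_def bilinear_def d2_def
    by (intro conjI allI linearI) (simp_all add: s mu(2) algebra_simps)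
qed

section \<open>Generalized metrics and their tangent vectors\<close>

lemma block_op_apply: "blinfun_apply (block_op A B C D) (X, \<xi>) = (A X + B \<xi>, C X + D \<xi>)"
proof -
  have "bounded_linear (\<lambda>u. (A (fst u) + B (snd u), C (fst u) + D (snd u)))"
    by (intro bounded_linear_intros bounded_linear_fst bounded_linear_snd
        bounded_linear_compose[OF blinfun.bounded_linear_right])
  then show ?thesis
    by (simp add: block_op_def case_prod_unfold bounded_linear_Blinfun_apply)
qed

lemma exp_b_apply: "blinfun_apply (exp_b b) (X, \<xi>) = (X, flat_op b X + \<xi>)"
  by (simp add: exp_b_def block_op_apply)

lemma flat_op_uminus: "bilinear b \<Longrightarrow> blinfun_apply (flat_op (\<lambda>X Y. - b X Y)) X = - flat_op b X"
proof (rule blinfun_eqI)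
  fix Y assume b: "bilinear b"
  then have "bilinear (\<lambda>X Y. - b X Y)"
    unfolding bilinear_def by (auto intro: linear_compose_neg)
  with b show "blinfun_apply (flat_op (\<lambda>X Y. - b X Y) X) Y = blinfun_apply (- flat_op b X) Y"
    by (simp add: flat_op_apply blinfun.minus_left)
qed

lemma pairing_eq: "pairing u v = (blinfun_apply (snd u) (fst v) + blinfun_apply (snd v) (fst u)) / 2"
  by (cases u; cases v) simp

lemma gen_metric_of_apply:
  assumes "bilinear b"
  shows "blinfun_apply (gen_metric_of g b) (X, \<xi>) =
    (sharp_op g (\<xi> - flat_op b X), flat_op g X + flat_op b (sharp_op g (\<xi> - flat_op b X)))"
  using assms by (simp add: gen_metric_of_def exp_b_apply block_op_apply flat_op_uminus add.commute)

text \<open>A generalized metric is handled through the splitting that it induces. Every vector of the double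
  is \<open>e\<^sup>b (X + g Y)\<close> for unique \<open>X\<close> and \<open>Y\<close>; in these coordinates the pairing depends on \<open>g\<close>
  alone, the generalized metric exchanges \<open>X\<close> and \<open>Y\<close>, and endomorphisms are blocks of
  endomorphisms of the Lie algebra, without dual spaces.\<close>

locale metric_b_pair = metric g for g :: "'a::euclidean_space \<Rightarrow> 'a \<Rightarrow> real" +
  fixes b :: "'a \<Rightarrow> 'a \<Rightarrow> real"
  assumes b: "two_form b"
begin

lemma b_bilinear: "bilinear b" and b_skew: "b X Y = - b Y X"
  using b two_form_skew by (auto simp: two_form_def)

definition frame :: "'a \<Rightarrow> 'a \<Rightarrow> 'a double" where
  "frame X Y = (X, flat_op g Y + flat_op b X)"

definition b_sharp :: "'a \<Rightarrow> 'a" where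
  "b_sharp X = sharp_op g (flat_op b X)"

lemma g_b_sharp: "g (b_sharp X) Y = b X Y"
  by (simp add: b_sharp_def g_sharp flat_op_apply[OF b_bilinear])

lemma b_sharp_linear: "linear b_sharp"
  unfolding b_sharp_def by (intro linearI) (simp_all add: blinfun.add_right blinfun.scaleR_right)

lemma frame_add: "frame X Y + frame X' Y' = frame (X + X') (Y + Y')"
  and frame_scaleR: "r *\<^sub>R frame X Y = frame (r *\<^sub>R X) (r *\<^sub>R Y)"
  and frame_uminus: "- frame X Y = frame (- X) (- Y)"
  by (simp_all add: frame_def blinfun.add_right blinfun.scaleR_right blinfun.minus_right algebra_simps)

lemma frame_eq_iff: "frame X Y = frame X' Y' \<longleftrightarrow> X = X' \<and> Y = Y'"
  unfolding frame_def using bij_is_inj[OF flat_bij] by (auto dest: injD)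

lemma frame_cases: obtains X Y where "u = frame X Y"
proof
  show "u = frame (fst u) (sharp_op g (snd u - flat_op b (fst u)))"
    by (simp add: frame_def)
qed

lemma pairing_frame: "pairing (frame X Y) (frame X' Y') = (g Y X' + g Y' X) / 2"
  using b_skew[of X X'] by (simp add: frame_def flat_op_apply[OF g_bilinear] flat_op_apply[OF b_bilinear] blinfun.add_left)

lemma gen_metric_frame: "blinfun_apply (gen_metric_of g b) (frame X Y) = frame Y X"
  by (simp add: frame_def gen_metric_of_apply[OF b_bilinear])

lemma endo_eqI: "(\<And>X Y. blinfun_apply A (frame X Y) = blinfun_apply B (frame X Y)) \<Longrightarrow> A = B"
  by (rule blinfun_eqI) (metis frame_cases)

text \<open>The vectors \<open>i\<close> and \<open>g\<^sup>-\<^sup>1 (\<cdot> \<bullet> i)\<close> form \<open>g\<close>-dual bases, so this contraction is the one with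
  an orthonormal frame.\<close>

lemma basis_dual_contraction:
  assumes "bilinear f"
  shows "(\<Sum>i\<in>Basis. f (sharp_op g (blinfun_inner_left i)) i) = (\<Sum>e\<in>E. (f e e :: real))"
proof -
  have "(\<Sum>i\<in>Basis. f (sharp_op g (blinfun_inner_left i)) i) = (\<Sum>i\<in>Basis. \<Sum>e\<in>E. (e \<bullet> i) *\<^sub>R f e i)"
    by (simp add: sharp_apply bilinear_sum_left[OF assms] inner_commute)
  also have "\<dots> = (\<Sum>e\<in>E. f e (\<Sum>i\<in>Basis. (e \<bullet> i) *\<^sub>R i))"
    by (subst sum.swap) (simp add: bilinear_sum_right[OF assms])
  finally show ?thesis by (simp add: euclidean_representation)
qed

text \<open>The trace is taken in the untwisted splitting. Passing to the splitting twisted by \<open>b\<close> adds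
  \<open>- tr (Q b\<^sub>\<sharp>)\<close> to the trace of the first diagonal block and \<open>tr (b\<^sub>\<sharp> Q)\<close> to that of the second,
  which cancel.\<close>

lemma endo_trace_frame:
  assumes lin: "linear P" "linear Q" "linear R" "linear S"
    and A: "\<And>X Y. blinfun_apply A (frame X Y) = frame (P X + Q Y) (R X + S Y)"
  shows "endo_trace A = (\<Sum>e\<in>E. g (P e) e) + (\<Sum>e\<in>E. g (S e) e)"
proof -
  have lins: "linear (\<lambda>X. Q (b_sharp X))"
    using linear_compose[OF b_sharp_linear lin(2)] by (simp add: o_def)
  have "(X, 0) = frame X (- b_sharp X)" for X
    by (simp add: frame_def b_sharp_def blinfun.minus_right)
  then have 1: "fst (blinfun_apply A (X, 0)) = P X - Q (b_sharp X)" for X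
    by (simp add: A linear_neg[OF lin(2)]) (simp add: frame_def)
  have "(\<Sum>i\<in>Basis. fst (blinfun_apply A (i, 0)) \<bullet> i) = lin_trace (\<lambda>X. P X - Q (b_sharp X))"
    by (simp add: 1 lin_trace_def)
  also have "\<dots> = (\<Sum>e\<in>E. g (P e) e) - (\<Sum>e\<in>E. g (Q (b_sharp e)) e)"
    by (subst lin_trace_onb) (simp_all add: linear_compose_sub lin lins g_simps sum_subtractf)
  finally have first: "(\<Sum>i\<in>Basis. fst (blinfun_apply A (i, 0)) \<bullet> i) =
    (\<Sum>e\<in>E. g (P e) e) - (\<Sum>e\<in>E. g (Q (b_sharp e)) e)" .
  have "(0, \<xi>) = frame 0 (sharp_op g \<xi>)" for \<xi>
    by (simp add: frame_def)
  then have 2: "blinfun_apply (snd (blinfun_apply A (0, \<xi>))) Z =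
      g (S (sharp_op g \<xi>)) Z + b (Q (sharp_op g \<xi>)) Z" for \<xi> Z
    by (simp add: A linear_0 lin)
      (simp add: frame_def blinfun.add_left flat_op_apply[OF g_bilinear] flat_op_apply[OF b_bilinear])
  have "bilinear (\<lambda>Y Z. g (S Y) Z + b (Q Y) Z)"
    unfolding bilinear_def by (intro conjI allI linearI)
      (simp_all add: g_simps bilin_simps[OF b_bilinear] linear_add linear_cmul lin algebra_simps)
  then have "(\<Sum>i\<in>Basis. blinfun_apply (snd (blinfun_apply A (0, blinfun_inner_left i))) i) =
      (\<Sum>e\<in>E. g (S e) e) + (\<Sum>e\<in>E. g (b_sharp (Q e)) e)"
    unfolding 2 by (subst basis_dual_contraction) (simp_all add: sum.distrib g_b_sharp)
  with first show ?thesis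
    unfolding endo_trace_def trace_commute[OF lin(2) b_sharp_linear] by simp
qed

text \<open>The block form of a tangent vector \<open>A\<close>, i.e. of an endomorphism that is skew for the pairing and
  anticommutes with the generalized metric: \<open>P\<close> is the variation of \<open>g\<close> and \<open>Q\<close> that of \<open>b\<close>, both
  with an index raised.\<close>

definition tangent_blocks :: "('a \<Rightarrow> 'a) \<Rightarrow> ('a \<Rightarrow> 'a) \<Rightarrow> 'a endo \<Rightarrow> bool" where
  "tangent_blocks P Q A \<longleftrightarrow> linear P \<and> linear Q \<and>
     (\<forall>X Y. g (P X) Y = g X (P Y)) \<and> (\<forall>X Y. g (Q X) Y = - g X (Q Y)) \<and>
     (\<forall>X Y. blinfun_apply A (frame X Y) = frame (P X + Q Y) (- Q X - P Y))"

text \<open>The two conditions on tangent endomorphisms, tested on vectors \<open>frame X 0\<close> and \<open>frame 0 Y\<close>, are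
  linear relations between the four blocks that leave \<open>P\<close> and \<open>Q\<close> free.\<close>

lemma tangent_endos_iff:
  "A \<in> tangent_endos (gen_metric_of g b) \<longleftrightarrow> (\<exists>P Q. tangent_blocks P Q A)"
proof
  assume A: "A \<in> tangent_endos (gen_metric_of g b)"
  let ?G = "gen_metric_of g b"
  define snd' where "snd' u = sharp_op g (snd u - flat_op b (fst u))" for u :: "'a double"
  have u: "u = frame (fst u) (snd' u)" for u by (simp add: frame_def snd'_def)
  define P where "P X = fst (blinfun_apply A (frame X 0))" for X
  define Q where "Q X = fst (blinfun_apply A (frame 0 X))" for X
  define R where "R X = snd' (blinfun_apply A (frame X 0))" for X
  define S where "S X = snd' (blinfun_apply A (frame 0 X))" for X
  have AX: "blinfun_apply A (frame X 0) = frame (P X) (R X)" and AY: "blinfun_apply A (frame 0 X) = frame (Q X) (S X)" for X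
    unfolding P_def Q_def R_def S_def by (rule u)+
  have AXY: "blinfun_apply A (frame X Y) = frame (P X + Q Y) (R X + S Y)" for X Y
    using frame_add[of X 0 0 Y] by (simp flip: frame_add AX AY add: blinfun.add_right[symmetric])
  have linP: "linear P" and linQ: "linear Q"
    unfolding P_def Q_def
    using frame_add[of _ 0 _ 0, symmetric] frame_scaleR[of _ _ 0, symmetric]
      frame_add[of 0 _ 0 _, symmetric] frame_scaleR[of _ 0 _, symmetric]
    by (auto intro!: linearI simp: blinfun.add_right blinfun.scaleR_right)
  have skew: "pairing (blinfun_apply A u) v + pairing u (A v) = 0"
    and symm: "pairing (?G (A u)) v = pairing (?G u) (A v)" for u v
    using A by (simp_all add: tangent_endos_def gen_inner_def del: split_paired_All)
  have PS: "g Y (P X) + g (S Y) X = 0" for X Y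
    using skew[of "frame X 0" "frame 0 Y"] by (simp add: AX AY pairing_frame g_simps)
  have QQ: "g Y (Q Y') + g Y' (Q Y) = 0" for Y Y'
    using skew[of "frame 0 Y" "frame 0 Y'"] by (simp add: AY pairing_frame g_simps)
  have PP: "g (P X) X' = g X (P X')" for X X'
    using symm[of "frame X 0" "frame X' 0"] by (simp add: AX gen_metric_frame pairing_frame g_simps)
  have RQ: "g Y (R X) = g (Q Y) X" for X Y
    using symm[of "frame X 0" "frame 0 Y"]
    by (simp add: AX AY gen_metric_frame pairing_frame g_simps sym[of X "Q Y"])
  have "S Y = - P Y" for Y
  proof (rule eqI)
    fix Z show "g (S Y) Z = g (- P Y) Z" using PS[of Y Z] PP[of Y Z] by (simp add: g_simps)
  qed
  moreover have "R X = - Q X" for X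
  proof (rule eqI)
    fix Z show "g (R X) Z = g (- Q X) Z"
      using RQ[of Z X] QQ[of X Z] by (simp add: g_simps sym[of _ X] sym[of _ Z])
  qed
  moreover have "g (Q X) Y = - g X (Q Y)" for X Y
    using QQ[of X Y] by (simp add: sym[of _ Y])
  ultimately have "tangent_blocks P Q A"
    unfolding tangent_blocks_def using linP linQ PP by (auto simp: AXY)
  then show "\<exists>P Q. tangent_blocks P Q A" by blast
next
  assume "\<exists>P Q. tangent_blocks P Q A"
  then obtain P Q where PQ: "tangent_blocks P Q A" by blast
  then have P: "g (P X) Y = g X (P Y)" and Q: "g (Q X) Y = - g X (Q Y)"
    and A: "blinfun_apply A (frame X Y) = frame (P X + Q Y) (- Q X - P Y)" for X Y
    by (auto simp: tangent_blocks_def)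
  have s: "g X (P Y) = g Y (P X)" "g X (Q Y) = - g Y (Q X)" for X Y
    using P[of Y X] Q[of Y X] by (simp_all add: sym)
  show "A \<in> tangent_endos (gen_metric_of g b)"
    unfolding tangent_endos_def gen_inner_def
  proof (intro CollectI conjI allI)
    fix u v :: "'a double"
    obtain X Y where u: "u = frame X Y" by (rule frame_cases)
    obtain X' Y' where v: "v = frame X' Y'" by (rule frame_cases)
    show "pairing (blinfun_apply A u) v + pairing u (blinfun_apply A v) = 0"
      unfolding u v using s(1)[of X' Y] s(1)[of X Y'] s(2)[of X X'] s(2)[of Y Y']
      by (simp add: A pairing_frame g_simps P Q field_simps)
    show "2 * pairing (gen_metric_of g b (blinfun_apply A u)) v
        = 2 * pairing (gen_metric_of g b u) (blinfun_apply A v)"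
      unfolding u v using s(1)[of X X'] s(1)[of Y Y'] s(2)[of X Y'] s(2)[of Y X']
      by (simp add: A gen_metric_frame pairing_frame g_simps P Q field_simps)
  qed
qed

lemma sym_metric_frame:
  assumes "tangent_blocks P Q A" "tangent_blocks P' Q' A'"
  shows "sym_metric A A' = 2 * (\<Sum>e\<in>E. g (P' e) (P e)) + 2 * (\<Sum>e\<in>E. g (Q' e) (Q e))"
proof -
  have lin: "linear P" "linear Q" "linear P'" "linear Q'"
    using assms by (auto simp: tangent_blocks_def)
  note c = linear_compose[OF lin(3) lin(1)] linear_compose[OF lin(4) lin(2)]
    linear_compose[OF lin(3) lin(2)] linear_compose[OF lin(4) lin(1)]
  have "sym_metric A A' = (\<Sum>e\<in>E. g (P (P' e) - Q (Q' e)) e) + (\<Sum>e\<in>E. g (P (P' e) - Q (Q' e)) e)"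
    unfolding sym_metric_def
  proof (rule endo_trace_frame[where Q = "\<lambda>X. P (Q' X) - Q (P' X)" and R = "\<lambda>X. P (Q' X) - Q (P' X)"])
    show "linear (\<lambda>X. P (P' X) - Q (Q' X))" "linear (\<lambda>X. P (Q' X) - Q (P' X))"
      "linear (\<lambda>X. P (Q' X) - Q (P' X))" "linear (\<lambda>X. P (P' X) - Q (Q' X))"
      using c by (auto simp: o_def intro!: linear_compose_sub)
    show "blinfun_apply (A o\<^sub>L A') (frame X Y) =
      frame (P (P' X) - Q (Q' X) + (P (Q' Y) - Q (P' Y))) (P (Q' X) - Q (P' X) + (P (P' Y) - Q (Q' Y)))" for X Y
      using assms by (simp add: tangent_blocks_def frame_eq_iff linear_add linear_diff linear_neg algebra_simps)
  qed
  moreover have "g (P (P' e) - Q (Q' e)) e = g (P' e) (P e) + g (Q' e) (Q e)" for e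
    using assms by (simp add: tangent_blocks_def g_simps)
  ultimately show ?thesis by (simp add: sum.distrib)
qed

text \<open>On blocks the symmetric metric is twice the sum of the two Hilbert--Schmidt norms.\<close>

lemma sym_metric_definite:
  assumes A: "A \<in> tangent_endos (gen_metric_of g b)" and 0: "sym_metric A A = 0"
  shows "A = 0"
proof -
  obtain P Q where PQ: "tangent_blocks P Q A" using A tangent_endos_iff by blast
  then have lin: "linear P" "linear Q" by (auto simp: tangent_blocks_def)
  have "(\<Sum>e\<in>E. g (P e) (P e)) + (\<Sum>e\<in>E. g (Q e) (Q e)) = 0"
    using 0 by (simp add: sym_metric_frame[OF PQ PQ])
  moreover have "(\<Sum>e\<in>E. g (P e) (P e)) \<ge> 0" "(\<Sum>e\<in>E. g (Q e) (Q e)) \<ge> 0"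
    by (simp_all add: nonneg sum_nonneg)
  ultimately have "(\<Sum>e\<in>E. g (P e) (P e)) = 0" "(\<Sum>e\<in>E. g (Q e) (Q e)) = 0" by linarith+
  then have "\<forall>e\<in>E. g (P e) (P e) = 0" "\<forall>e\<in>E. g (Q e) (Q e) = 0"
    by (simp_all add: sum_nonneg_eq_0_iff fin nonneg)
  then have "\<forall>e\<in>E. P e = 0" "\<forall>e\<in>E. Q e = 0" using pos by force+
  then have "P X = 0" "Q X = 0" for X
    using expand_linear[OF lin(1), of X] expand_linear[OF lin(2), of X] by simp_all
  then show ?thesis using PQ
    by (intro endo_eqI) (simp add: tangent_blocks_def frame_def zero_prod_def)
qed

end

lemma gen_metric_self_adjoint:
  assumes "G \<in> gen_metrics"
  shows "pairing (blinfun_apply G u) v = pairing u (G v)"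
proof -
  have "G (G v) = v" using assms
    by (simp add: gen_metrics_def) (metis blinfun_apply_blinfun_compose blinfun_apply_id_blinfun id_apply)
  then show ?thesis using assms unfolding gen_metrics_def by (metis (mono_tags, lifting) mem_Collect_eq)
qed

lemma gen_metric_involution: "G \<in> gen_metrics \<Longrightarrow> blinfun_apply G (blinfun_apply G v) = v"
  by (simp add: gen_metrics_def) (metis blinfun_apply_blinfun_compose blinfun_apply_id_blinfun id_apply)

lemma gen_metric_of_inject:
  assumes "inner_product g" "two_form b" "inner_product g'" "two_form b'"
    and eq: "gen_metric_of g b = gen_metric_of g' b'"
  shows "g = g' \<and> b = b'"
proof -
  interpret p: metric_b_pair g b using assms by unfold_locales
  interpret q: metric_b_pair g' b' using assms by unfold_locales
  have f: "sharp_op g (\<xi> - flat_op b X) = sharp_op g' (\<xi> - flat_op b' X)" for X \<xi>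
    using arg_cong[OF eq, of "\<lambda>G. fst (blinfun_apply G (X, \<xi>))"]
    by (simp add: gen_metric_of_apply[OF p.b_bilinear] gen_metric_of_apply[OF q.b_bilinear])
  have s: "sharp_op g \<xi> = sharp_op g' \<xi>" for \<xi>
    using f[of \<xi> 0] by simp
  have "flat_op g X = flat_op g' X" for X
    by (metis s q.sharp_flat p.flat_sharp)
  then have "g = g'" by (intro ext) (metis flat_op_apply p.g_bilinear q.g_bilinear)
  moreover have "flat_op b X = flat_op b' X" for X
    using f[of 0 X] s by (simp add: blinfun.minus_right) (metis p.flat_sharp s)
  then have "b = b'" by (intro ext) (metis flat_op_apply p.b_bilinear q.b_bilinear)
  ultimately show ?thesis by blast
qed

lemma metric_inner: "metric (\<bullet>)"
  by unfold_locales (auto simp: inner_product_def inner_commute bilinear_conv_bounded_bilinear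
      bounded_bilinear_inner)

text \<open>The block \<open>K\<close> of \<open>G\<close> from the dual to the Lie algebra is symmetric and positive, hence the
  inverse of an inner product \<open>g\<close>, and the block \<open>L\<close> on the Lie algebra has to be \<open>- g\<^sup>-\<^sup>1 b\<close>. That
  the resulting \<open>b\<close> is skew is the off-diagonal part \<open>L K + K L\<^sup>* = 0\<close> of \<open>G\<^sup>2 = 1\<close>. Involutivity
  also determines the remaining component of \<open>G\<close> from \<open>K\<close> and \<open>L\<close>.\<close>

lemma gen_metric_exists:
  fixes G :: "'a::euclidean_space endo"
  assumes G: "G \<in> gen_metrics"
  shows "\<exists>g b. inner_product g \<and> two_form b \<and> G = gen_metric_of g b"
proof -
  interpret i: metric "(\<bullet>) :: 'a \<Rightarrow> _" by (rule metric_inner)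
  define K where "K \<xi> = fst (blinfun_apply G (0, \<xi>))" for \<xi>
  define N where "N \<xi> = snd (blinfun_apply G (0, \<xi>))" for \<xi>
  define L where "L X = fst (blinfun_apply G (X, 0))" for X
  have split: "(X, \<xi>) = (X, 0) + (0, \<xi>)" for X :: 'a and \<xi> :: "'a dual" by simp
  have fstG: "fst (blinfun_apply G (X, \<xi>)) = L X + K \<xi>" for X \<xi>
    unfolding L_def K_def by (subst split, simp only: blinfun.add_right fst_add)
  have "(0, \<xi> + \<eta>) = (0, \<xi>) + (0 :: 'a, \<eta>)" "(0, r *\<^sub>R \<xi>) = r *\<^sub>R (0 :: 'a, \<xi>)" for \<xi> \<eta> :: "'a dual" and r
    by simp_all
  then have linK: "linear K" unfolding K_def
    by (intro linearI) (simp_all only: blinfun.add_right blinfun.scaleR_right fst_add fst_scaleR)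
  have "(X + Y, 0) = (X, 0) + (Y, 0 :: 'a dual)" "(r *\<^sub>R X, 0) = r *\<^sub>R (X, 0 :: 'a dual)" for X Y :: 'a and r
    by simp_all
  then have linL: "linear L" unfolding L_def
    by (intro linearI) (simp_all only: blinfun.add_right blinfun.scaleR_right fst_add fst_scaleR)
  have Ksym: "blinfun_apply \<eta> (K \<xi>) = blinfun_apply \<xi> (K \<eta>)" for \<xi> \<eta>
    using gen_metric_self_adjoint[OF G, of "(0, \<xi>)" "(0, \<eta>)"]
    by (simp add: pairing_eq K_def)
  have Kpos: "blinfun_apply \<xi> (K \<xi>) > 0" if "\<xi> \<noteq> 0" for \<xi>
  proof -
    have "pairing (blinfun_apply G (0, \<xi>)) (0, \<xi>) > 0"
      using G that by (auto simp: gen_metrics_def zero_prod_def)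
    then show ?thesis by (simp add: pairing_eq K_def)
  qed
  have NL: "blinfun_apply (N \<xi>) X = blinfun_apply \<xi> (L X)" for \<xi> X
    using gen_metric_self_adjoint[OF G, of "(0, \<xi>)" "(X, 0)"]
    by (simp add: pairing_eq N_def L_def)
  have LK: "L (K \<xi>) + K (N \<xi>) = 0" for \<xi>
    using gen_metric_involution[OF G, of "(0, \<xi>)"] fstG[of "K \<xi>" "N \<xi>"]
    by (simp add: K_def N_def)
  have injK: "inj K"
    using linear_injective_0[OF linK] Kpos by (metis blinfun.zero_right order_less_irrefl)
  have "linear (\<lambda>X. K (flat_op (\<bullet>) X))"
    using linear_compose[OF bounded_linear.linear[OF blinfun.bounded_linear_right] linK]
    by (simp add: o_def)
  moreover have "inj (\<lambda>X. K (flat_op (\<bullet>) X))"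
    using injK bij_is_inj[OF i.flat_bij] by (metis (no_types, lifting) injD injI)
  ultimately have "surj (\<lambda>X. K (flat_op (\<bullet>) X))"
    by (rule linear_inj_imp_surj)
  then have surjK: "surj K" unfolding surj_def by blast
  define J where "J = inv K"
  have KJ: "K (J X) = X" and JK: "J (K \<xi>) = \<xi>" for X \<xi>
    using injK surjK by (simp_all add: J_def surj_f_inv_f)
  have linJ: "linear J"
  proof (rule linearI)
    show "J (X + Y) = J X + J Y" for X Y
      using JK[of "J X + J Y"] by (simp add: linear_add[OF linK] KJ)
    show "J (r *\<^sub>R X) = r *\<^sub>R J X" for r X
      using JK[of "r *\<^sub>R J X"] by (simp add: linear_cmul[OF linK] KJ)
  qed
  define g where "g X Y = blinfun_apply (J X) Y" for X Y
  define b where "b X Y = - g (L X) Y" for X Y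
  have g: "inner_product g"
    unfolding inner_product_def
  proof (intro conjI allI impI)
    show "bilinear g" unfolding bilinear_def g_def
      by (intro conjI allI linearI)
        (simp_all add: blinfun.add_right blinfun.scaleR_right linear_add[OF linJ] linear_cmul[OF linJ]
          blinfun.add_left blinfun.scaleR_left)
    show "g X Y = g Y X" for X Y
      using Ksym[of "J X" "J Y"] by (simp add: g_def KJ)
    show "g X X > 0" if "X \<noteq> 0" for X
    proof -
      have "J X \<noteq> 0" using that KJ[of X] linear_0[OF linK] by auto
      then show ?thesis using Kpos[of "J X"] by (simp add: g_def KJ)
    qed
  qed
  then interpret metric g by unfold_locales
  have b: "two_form b"
    unfolding two_form_def
  proof (intro conjI allI)
    show "bilinear b" unfolding bilinear_def b_def
      by (intro conjI allI linearI) (simp_all add: g_simps linear_add[OF linL] linear_cmul[OF linL])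
    fix X
    define \<xi> where "\<xi> = J X"
    have "blinfun_apply \<xi> (L (K \<xi>)) = - blinfun_apply \<xi> (K (N \<xi>))"
      using arg_cong[OF LK[of \<xi>], of "blinfun_apply \<xi>"] by (simp add: blinfun.add_right)
    also have "blinfun_apply \<xi> (K (N \<xi>)) = blinfun_apply \<xi> (L (K \<xi>))"
      by (simp add: Ksym[of \<xi>] NL)
    finally have "g X (L X) = 0" by (simp add: g_def \<xi>_def KJ)
    then show "b X X = 0" by (simp add: b_def sym)
  qed
  interpret metric_b_pair g b using b by unfold_locales
  have flat: "blinfun_apply (flat_op g) X = J X" for X
    by (rule blinfun_eqI) (simp add: flat_op_apply[OF g_bilinear] g_def)
  then have sharp: "blinfun_apply (sharp_op g) \<xi> = K \<xi>" for \<xi>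
    by (metis JK sharp_flat)
  have flatb: "blinfun_apply (flat_op b) X = - J (L X)" for X
    by (rule blinfun_eqI) (simp add: flat_op_apply[OF b_bilinear] b_def g_def blinfun.minus_left)
  let ?G = "gen_metric_of g b"
  \<comment> \<open>Both involutions have the same first component, and the first component of their square
    recovers the second one, as \<open>K\<close> is injective.\<close>
  have fst_eq: "fst (blinfun_apply ?G u) = fst (blinfun_apply G u)" for u
    by (cases u) (simp add: gen_metric_of_apply[OF b_bilinear] fstG sharp flatb linear_add[OF linK] KJ)
  have inv: "blinfun_apply ?G (?G u) = u" for u
    by (rule frame_cases[of u]) (simp add: gen_metric_frame)
  have sndK: "K (snd (blinfun_apply G u)) = fst u - L (fst (blinfun_apply G u))" for u
    using fstG[of "fst (blinfun_apply G u)" "snd (blinfun_apply G u)"]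
    by (simp add: gen_metric_involution[OF G])
  have sndK': "K (snd (blinfun_apply ?G u)) = fst u - L (fst (blinfun_apply ?G u))" for u
    using fstG[of "fst (blinfun_apply ?G u)" "snd (blinfun_apply ?G u)"] fst_eq[of "?G u"]
    by (simp add: inv)
  have "snd (blinfun_apply ?G u) = snd (blinfun_apply G u)" for u
    using sndK[of u] sndK'[of u] fst_eq[of u] injD[OF injK] by simp
  then have "G = ?G" using fst_eq by (intro blinfun_eqI) (simp add: prod_eq_iff)
  then show ?thesis using g b by blast
qed

lemma metric_b_field_gen_metric_of:
  assumes "inner_product g" "two_form b"
  shows "metric_b_field (gen_metric_of g b) = (g, b)"
  unfolding metric_b_field_def
proof (rule the_equality)
  fix p assume "inner_product (fst p) \<and> two_form (snd p) \<and>
    gen_metric_of g b = gen_metric_of (fst p) (snd p)"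
  then show "p = (g, b)"
    using gen_metric_of_inject[of g b "fst p" "snd p"] assms by (simp add: prod_eq_iff)
qed (use assms in simp)

section \<open>Uniqueness of the gradient\<close>

text \<open>The inverse of \<open>1 - C\<close>, obtained from the contraction \<open>w \<mapsto> u + C w\<close>.\<close>

lemma resolvent_exists:
  fixes C :: "'v::banach \<Rightarrow>\<^sub>L 'v"
  assumes C: "norm C \<le> 1/2"
  shows "\<exists>R :: 'v \<Rightarrow>\<^sub>L 'v. norm R \<le> 2 \<and>
    (\<forall>u. blinfun_apply R u - blinfun_apply C (blinfun_apply R u) = u) \<and>
    (\<forall>w. blinfun_apply R (w - blinfun_apply C w) = w)"
proof -
  have Cle: "norm (C w) \<le> (1/2) * norm w" for w
    using norm_blinfun[of C w] mult_right_mono[OF C, of "norm w"] by simp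
  have "\<exists>!w. u + C w = w" for u
  proof (rule banach_fix_type[of "1/2"])
    show "\<forall>x y. dist (u + C x) (u + C y) \<le> 1 / 2 * dist x y"
      using Cle by (simp add: dist_norm flip: blinfun.diff_right)
  qed auto
  then obtain R where R: "u + C (R u) = R u" and uniq: "u + C w = w \<Longrightarrow> R u = w" for u w
    by metis
  have bound: "norm (R u) \<le> norm u * 2" for u
    using R[of u] Cle[of "R u"] norm_triangle_ineq[of u "C (R u)"] by simp
  have "bounded_linear R"
  proof (rule bounded_linear_intro)
    fix x y and r :: real
    have "x + y + C (R x + R y) = (x + C (R x)) + (y + C (R y))"
      by (simp add: blinfun.add_right algebra_simps)
    then show "R (x + y) = R x + R y" by (intro uniq) (simp only: R)
    have "r *\<^sub>R x + C (r *\<^sub>R R x) = r *\<^sub>R (x + C (R x))"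
      by (simp add: blinfun.scaleR_right scaleR_add_right)
    then show "R (r *\<^sub>R x) = r *\<^sub>R R x" by (intro uniq) (simp only: R)
  qed (rule bound)
  then obtain R' where R': "R = blinfun_apply R'" using bounded_linear_Blinfun_apply by metis
  have "norm R' \<le> 2"
    by (rule norm_blinfun_bound) (use bound R' in \<open>auto simp: mult.commute\<close>)
  moreover have "R u - C (R u) = u" for u using R[of u] by (simp add: algebra_simps)
  moreover have "R (w - C w) = w" for w by (rule uniq) simp
  ultimately show ?thesis unfolding R' by blast
qed

lemma pairing_add: "pairing (u + u') v = pairing u v + pairing u' v"
    "pairing u (v + v') = pairing u v + pairing u v'"
  and pairing_diff: "pairing (u - u') v = pairing u v - pairing u' v"
    "pairing u (v - v') = pairing u v - pairing u v'"
  and pairing_scaleR: "pairing (r *\<^sub>R u) v = r * pairing u v" "pairing u (r *\<^sub>R v) = r * pairing u v"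
  by (simp_all add: pairing_eq blinfun.add_left blinfun.add_right blinfun.diff_left blinfun.diff_right
      blinfun.scaleR_left blinfun.scaleR_right field_simps)

lemma pairing_nondegenerate:
  assumes "\<And>v. pairing u v = 0" shows "u = 0"
proof -
  have "snd u = 0"
    using assms[of "(_, 0)"] by (intro blinfun_eqI) (simp add: pairing_eq)
  moreover have "fst u = 0"
    using assms[of "(0, blinfun_inner_left (fst u))"] by (simp add: pairing_eq)
  ultimately show ?thesis by (simp add: prod_eq_iff)
qed

lemma tangent_anticommute:
  assumes G: "G \<in> gen_metrics" and B: "B \<in> tangent_endos G"
  shows "blinfun_apply G (B u) = - B (G u)"
proof -
  have "pairing (G (B u) + B (G u)) v = 0" for v
  proof -
    have "pairing (G (B u)) v = pairing (G u) (B v)"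
      using B by (simp add: tangent_endos_def gen_inner_def del: split_paired_All)
    moreover have "pairing (B (G u)) v + pairing (G u) (B v) = 0"
      using B by (simp add: tangent_endos_def del: split_paired_All)
    ultimately show ?thesis by (simp add: pairing_add)
  qed
  then have "G (B u) + B (G u) = 0" by (rule pairing_nondegenerate)
  then show ?thesis by (simp add: eq_neg_iff_add_eq_0)
qed

lemma (in metric) linear_g_bounded:
  assumes "linear P"
  shows "\<exists>M\<ge>0. \<forall>X. g (P X) (P X) \<le> M * g X X"
proof (intro exI conjI allI)
  let ?M = "\<Sum>f\<in>E. \<Sum>e\<in>E. (g (P e) f)\<^sup>2"
  show "?M \<ge> 0" by (simp add: sum_nonneg)
  fix X
  have "g (P X) (P X) = (\<Sum>f\<in>E. (g (P X) f)\<^sup>2)"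
    by (subst parseval) (simp add: power2_eq_square)
  also have "\<dots> \<le> (\<Sum>f\<in>E. (\<Sum>e\<in>E. (g X e)\<^sup>2) * (\<Sum>e\<in>E. (g (P e) f)\<^sup>2))"
  proof (rule sum_mono)
    fix f
    have "g (P X) f = (\<Sum>e\<in>E. g X e * g (P e) f)"
      by (subst expand_linear[OF assms]) (simp add: bilinear_sum_left[OF g_bilinear])
    then show "(g (P X) f)\<^sup>2 \<le> (\<Sum>e\<in>E. (g X e)\<^sup>2) * (\<Sum>e\<in>E. (g (P e) f)\<^sup>2)"
      by (simp add: Cauchy_Schwarz_ineq_sum)
  qed
  also have "\<dots> = ?M * g X X"
    by (subst parseval[of X X]) (simp add: power2_eq_square sum_distrib_left mult.commute)
  finally show "g (P X) (P X) \<le> ?M * g X X" .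
qed

lemma (in metric) g_add_le: "g (X + Y) (X + Y) \<le> 2 * g X X + 2 * g Y Y"
  using nonneg[of "X - Y"] by (simp add: g_simps)

context metric_b_pair begin

lemma gen_metric_of_mem: "gen_metric_of g b \<in> gen_metrics"
  unfolding gen_metrics_def
proof (intro CollectI conjI allI impI)
  fix u v :: "'a double"
  obtain X Y where u: "u = frame X Y" by (rule frame_cases)
  obtain X' Y' where v: "v = frame X' Y'" by (rule frame_cases)
  show "pairing (blinfun_apply (gen_metric_of g b) u) (gen_metric_of g b v) = pairing u v"
    by (simp add: u v gen_metric_frame pairing_frame sym add.commute)
next
  show "gen_metric_of g b o\<^sub>L gen_metric_of g b = id_blinfun"
    by (rule endo_eqI) (simp add: gen_metric_frame)
next
  fix u :: "'a double" assume "u \<noteq> 0"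
  obtain X Y where u: "u = frame X Y" by (rule frame_cases)
  with \<open>u \<noteq> 0\<close> have "X \<noteq> 0 \<or> Y \<noteq> 0" by (auto simp: frame_def zero_prod_def)
  then have "g X X + g Y Y > 0" using pos[of X] pos[of Y] nonneg[of X] nonneg[of Y] by fastforce
  then show "pairing (blinfun_apply (gen_metric_of g b) u) u > 0"
    by (simp add: u gen_metric_frame pairing_frame)
qed

text \<open>Boundedness of \<open>B\<close> for the inner product \<open>\<langle>G \<cdot>, \<cdot>\<rangle>\<close>, needed to keep generalized metrics positive
  when they move in the direction \<open>B\<close>.\<close>

lemma tangent_bounded:
  assumes "B \<in> tangent_endos (gen_metric_of g b)"
  shows "\<exists>M\<ge>0. \<forall>w. pairing (gen_metric_of g b (blinfun_apply B w)) (B w)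
    \<le> M * pairing (gen_metric_of g b w) w"
proof -
  obtain P Q where PQ: "tangent_blocks P Q B" using assms tangent_endos_iff by blast
  then obtain M N where M: "M \<ge> 0" "\<And>X. g (P X) (P X) \<le> M * g X X"
    and N: "N \<ge> 0" "\<And>X. g (Q X) (Q X) \<le> N * g X X"
    using linear_g_bounded[of P] linear_g_bounded[of Q] by (auto simp: tangent_blocks_def)
  show ?thesis
  proof (intro exI conjI allI)
    show "2 * (M + N) \<ge> 0" using M N by simp
    fix w
    obtain X Y where w: "w = frame X Y" by (rule frame_cases)
    have "g (- Q X - P Y) (- Q X - P Y) = g (Q X + P Y) (Q X + P Y)" by (simp add: g_simps)
    then have "g (P X + Q Y) (P X + Q Y) + g (- Q X - P Y) (- Q X - P Y)
      \<le> 2 * (g (P X) (P X) + g (P Y) (P Y)) + 2 * (g (Q X) (Q X) + g (Q Y) (Q Y))"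
      using g_add_le[of "P X" "Q Y"] g_add_le[of "Q X" "P Y"] by simp
    also have "\<dots> \<le> 2 * (M * g X X + M * g Y Y) + 2 * (N * g X X + N * g Y Y)"
      using M(2)[of X] M(2)[of Y] N(2)[of X] N(2)[of Y] by simp
    finally show "pairing (gen_metric_of g b (blinfun_apply B w)) (B w)
        \<le> 2 * (M + N) * pairing (gen_metric_of g b w) w"
      using PQ by (simp add: w tangent_blocks_def gen_metric_frame pairing_frame algebra_simps)
  qed
qed

end

text \<open>A derivative within \<open>gen_metrics\<close> is determined on \<open>G B\<close> because some curve in \<open>gen_metrics\<close> has
  this velocity, up to a factor. With \<open>C = s B\<close>, the Cayley transform \<open>(1 + C) (1 - C)\<^sup>-\<^sup>1\<close> is
  orthogonal as \<open>C\<close> is skew, and \<open>G' = G (1 + C) (1 - C)\<^sup>-\<^sup>1\<close> is an involution as \<open>G\<close> anticommutes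
  with \<open>C\<close>. On \<open>u = w - C w\<close> the form \<open>\<langle>G' u, u\<rangle>\<close> equals \<open>\<langle>G w, w\<rangle> - \<langle>G C w, C w\<rangle>\<close>, which is
  positive for small \<open>s\<close>. Since \<open>(1 + C) (1 - C)\<^sup>-\<^sup>1 = 1 + 2 C + O(s\<^sup>2)\<close>, the velocity is \<open>2 G B\<close>.\<close>

lemma cayley_curve:
  fixes G B :: "'a::euclidean_space endo"
  assumes G: "G \<in> gen_metrics" and B: "B \<in> tangent_endos G"
  shows "\<exists>\<delta>>0. \<exists>\<gamma>. (\<forall>s\<in>{0..\<delta>}. \<gamma> s \<in> gen_metrics) \<and> \<gamma> 0 = G \<and>
    (\<gamma> has_vector_derivative (2 *\<^sub>R (G o\<^sub>L B))) (at 0 within {0..\<delta>})"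
proof -
  have skew: "pairing (B u) v = - pairing u (B v)" for u v
  proof -
    have "pairing (B u) v + pairing u (B v) = 0"
      using B by (simp add: tangent_endos_def del: split_paired_All)
    then show ?thesis by (simp add: eq_neg_iff_add_eq_0)
  qed
  have symm: "pairing (G (B u)) v = pairing (G u) (B v)" for u v
    using B by (simp add: tangent_endos_def gen_inner_def del: split_paired_All)
  have orth: "pairing (G u) (G v) = pairing u v" for u v
    using G by (simp add: gen_metrics_def del: split_paired_All)
  have anti: "G (B u) = - B (G u)" for u by (rule tangent_anticommute[OF G B])
  have inv: "G (G u) = u" for u by (rule gen_metric_involution[OF G])
  have Gpos: "u \<noteq> 0 \<Longrightarrow> pairing (G u) u > 0" for u
    using G by (simp add: gen_metrics_def del: split_paired_All)
  obtain g b where "inner_product g" "two_form b" and Ggb: "G = gen_metric_of g b"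
    using gen_metric_exists[OF G] by blast
  then interpret metric_b_pair g b by unfold_locales
  obtain M where M: "M \<ge> 0" "\<And>w. pairing (G (B w)) (B w) \<le> M * pairing (G w) w"
    using tangent_bounded B unfolding Ggb by blast
  \<comment> \<open>Small enough for the resolvent (\<open>\<delta> \<parallel>B\<parallel> \<le> 1/2\<close>) and for positivity (\<open>\<delta>\<^sup>2 M < 1\<close>).\<close>
  define \<delta> where "\<delta> = 1 / (2 * (1 + norm B + M))"
  have d: "\<delta> > 0" using M by (simp add: \<delta>_def add_pos_nonneg)
  have dB: "\<delta> * norm B \<le> 1/2" and dM: "\<delta>\<^sup>2 * M < 1"
  proof -
    have p: "0 < 1 + norm B + M" using M by (simp add: add_pos_nonneg)
    show "\<delta> * norm B \<le> 1/2" using p M by (simp add: \<delta>_def field_simps)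
    have "\<delta> * M \<le> 1/2" "\<delta> \<le> 1/2" using p M by (simp_all add: \<delta>_def field_simps)
    then have "\<delta> * (\<delta> * M) \<le> (1/2) * (1/2)" using d M by (intro mult_mono) auto
    then show "\<delta>\<^sup>2 * M < 1" by (simp add: power2_eq_square mult.assoc)
  qed
  \<comment> \<open>Bounds the remainder \<open>G' - G - 2 s G B = 2 G C C R\<close>, where the resolvent has norm at most 2.\<close>
  define K where "K = 4 * norm G * (norm B)\<^sup>2"
  have "\<exists>G'\<in>gen_metrics. norm (G' - G - (2 * s) *\<^sub>R (G o\<^sub>L B)) \<le> K * s\<^sup>2" if s: "s \<in> {0..\<delta>}" for s
  proof -
    define C where "C = s *\<^sub>R B"
    have Cw: "C w = s *\<^sub>R B w" for w by (simp add: C_def blinfun.scaleR_left)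
    have sB: "s * norm B \<le> \<delta> * norm B" using s by (intro mult_right_mono) auto
    then have nC: "norm C \<le> 1/2" using dB s by (simp add: C_def)
    obtain R :: "'a endo" where R: "norm R \<le> 2"
        "\<And>u. blinfun_apply R u - C (blinfun_apply R u) = u"
        "\<And>w. blinfun_apply R (w - blinfun_apply C w) = w"
      using resolvent_exists[OF nC] by blast
    define G' where "G' = G o\<^sub>L (id_blinfun + C) o\<^sub>L R"
    have G'w: "G' (w - C w) = G (w + C w)" for w
      by (simp add: G'_def R(3) blinfun.add_left)
    have GC: "G (C w) = - C (G w)" for w by (simp add: Cw blinfun.scaleR_right anti)
    have Cskew: "pairing (C u) v = - pairing u (C v)" for u v
      by (simp add: Cw pairing_scaleR skew)
    have ex: "\<exists>w. u = w - C w" for u using R(2)[of u] by metis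
    have "G' \<in> gen_metrics"
      unfolding gen_metrics_def
    proof (intro CollectI conjI allI impI blinfun_eqI)
      fix u v
      obtain w z where u: "u = w - C w" and v: "v = z - C z" using ex by metis
      show "pairing (blinfun_apply G' u) (G' v) = pairing u v"
        unfolding u v G'w orth using Cskew[of w z]
        by (simp add: pairing_add pairing_diff)
    next
      fix u
      obtain w where u: "u = w - C w" using ex by metis
      have "G' u = G w - C (G w)" by (simp add: u G'w blinfun.add_right GC)
      then have "G' (G' u) = G (G w + C (G w))" by (simp only: G'w)
      also have "\<dots> = u" by (simp add: blinfun.add_right GC inv u)
      finally show "blinfun_apply (G' o\<^sub>L G') u = blinfun_apply id_blinfun u" by simp
    next
      fix u :: "'a double" assume "u \<noteq> 0"
      obtain w where u: "u = w - C w" using ex by metis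
      with \<open>u \<noteq> 0\<close> have w: "w \<noteq> 0" by (auto simp: blinfun.zero_right)
      have Csymm: "pairing (G (C w)) w = pairing (G w) (C w)"
        by (simp add: Cw pairing_scaleR blinfun.scaleR_right symm)
      have "pairing (G (C w)) (C w) = s\<^sup>2 * pairing (G (B w)) (B w)"
        by (simp add: Cw pairing_scaleR blinfun.scaleR_right power2_eq_square)
      also have "\<dots> \<le> s\<^sup>2 * (M * pairing (G w) w)" using M(2) by (simp add: mult_left_mono)
      also have "\<dots> \<le> \<delta>\<^sup>2 * (M * pairing (G w) w)"
        using s M(1) Gpos[OF w] by (intro mult_right_mono power_mono) auto
      also have "\<dots> < pairing (G w) w"
        using mult_strict_right_mono[OF dM Gpos[OF w]] by (simp add: mult.assoc)
      finally have "pairing (G (C w)) (C w) < pairing (G w) w" .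
      then show "pairing (blinfun_apply G' u) u > 0"
        unfolding u G'w using Csymm by (simp add: blinfun.add_right pairing_add pairing_diff)
    qed
    moreover have "norm (G' - G - (2 * s) *\<^sub>R (G o\<^sub>L B)) \<le> K * s\<^sup>2"
    proof (rule norm_blinfun_bound)
      show "K * s\<^sup>2 \<ge> 0" by (simp add: K_def)
      fix u
      define w where "w = R u"
      have u: "u = w - C w" by (simp add: w_def R(2))
      have "(G' - G - (2 * s) *\<^sub>R (G o\<^sub>L B)) u = G' u - G u - G (2 *\<^sub>R C u)"
        by (simp add: Cw blinfun.diff_left blinfun.scaleR_left blinfun.scaleR_right)
      also have "\<dots> = 2 *\<^sub>R G (C (C w))"
      proof -
        have "G' u = G w + G (C w)" unfolding u by (simp only: G'w blinfun.add_right)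
        moreover have "G u = G w - G (C w)" unfolding u by (simp only: blinfun.diff_right)
        moreover have "G (2 *\<^sub>R C u) = 2 *\<^sub>R (G (C w) - G (C (C w)))"
          unfolding u by (simp only: blinfun.diff_right blinfun.scaleR_right)
        ultimately show ?thesis by (simp add: scaleR_diff_right scaleR_2)
      qed
      also have "norm \<dots> \<le> 2 * (norm G * (norm C * (norm C * (norm R * norm u))))"
        unfolding w_def by (simp, intro order_trans[OF norm_blinfun] mult_left_mono) auto
      also have "\<dots> \<le> 2 * (norm G * (norm C * (norm C * (2 * norm u))))"
        using R(1) by (intro mult_left_mono mult_right_mono) auto
      also have "\<dots> = K * s\<^sup>2 * norm u"
        using s by (simp add: K_def C_def power2_eq_square)
      finally show "norm (blinfun_apply (G' - G - (2 * s) *\<^sub>R (G o\<^sub>L B)) u) \<le> K * s\<^sup>2 * norm u" .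
    qed
    ultimately show ?thesis by blast
  qed
  then obtain \<gamma> where \<gamma>: "\<And>s. s \<in> {0..\<delta>} \<Longrightarrow> \<gamma> s \<in> gen_metrics"
    "\<And>s. s \<in> {0..\<delta>} \<Longrightarrow> norm (\<gamma> s - G - (2 * s) *\<^sub>R (G o\<^sub>L B)) \<le> K * s\<^sup>2"
    by metis
  have \<gamma>0: "\<gamma> 0 = G" using \<gamma>(2)[of 0] d by simp
  have "(\<gamma> has_vector_derivative (2 *\<^sub>R (G o\<^sub>L B))) (at 0 within {0..\<delta>})"
    unfolding has_vector_derivative_def
  proof (rule has_derivativeI_sandwich[where e = 1 and H = "\<lambda>s. K * \<bar>s\<bar>"])
    show "bounded_linear (\<lambda>s. s *\<^sub>R 2 *\<^sub>R (G o\<^sub>L B))" by (rule bounded_linear_scaleR_left)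
    show "((\<lambda>s. K * \<bar>s\<bar>) \<longlongrightarrow> 0) (at 0 within {0..\<delta>})"
      by (rule tendsto_eq_intros refl | simp)+
    fix s assume "s \<in> {0..\<delta>}" "s \<noteq> 0"
    then show "norm (\<gamma> s - \<gamma> 0 - (s - 0) *\<^sub>R 2 *\<^sub>R (G o\<^sub>L B)) / norm (s - 0) \<le> K * \<bar>s\<bar>"
      using \<gamma>(2)[of s] by (simp add: \<gamma>0 divide_simps power2_eq_square mult.commute mult.left_commute mult.assoc)
  qed simp
  with d \<gamma>(1) \<gamma>0 show ?thesis by blast
qed

lemma derivative_on_tangents_unique:
  fixes G B :: "'a::euclidean_space endo" and f :: "'a endo \<Rightarrow> real"
  assumes G: "G \<in> gen_metrics" and B: "B \<in> tangent_endos G"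
    and D: "(f has_derivative D) (at G within gen_metrics)"
    and D': "(f has_derivative D') (at G within gen_metrics)"
  shows "D (G o\<^sub>L B) = D' (G o\<^sub>L B)"
proof -
  obtain \<delta> \<gamma> where d: "\<delta> > 0" and mem: "\<And>s. s \<in> {0..\<delta>} \<Longrightarrow> \<gamma> s \<in> gen_metrics"
    and \<gamma>0: "\<gamma> 0 = G"
    and der: "(\<gamma> has_vector_derivative (2 *\<^sub>R (G o\<^sub>L B))) (at 0 within {0..\<delta>})"
    using cayley_curve[OF G B] by blast
  have *: "((\<lambda>s. f (\<gamma> s)) has_vector_derivative F (2 *\<^sub>R (G o\<^sub>L B))) (at 0 within {0..\<delta>})"
    if F: "(f has_derivative F) (at G within gen_metrics)" for F
  proof -
    have "((\<lambda>s. f (\<gamma> s)) has_derivative (\<lambda>s. F (s *\<^sub>R 2 *\<^sub>R (G o\<^sub>L B)))) (at 0 within {0..\<delta>})"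
    proof (rule has_derivative_in_compose[OF der[unfolded has_vector_derivative_def]])
      show "(f has_derivative F) (at (\<gamma> 0) within \<gamma> ` {0..\<delta>})"
        unfolding \<gamma>0 using mem by (intro has_derivative_subset[OF F]) auto
    qed
    then show ?thesis
      using linear_cmul[OF has_derivative_linear[OF F]] by (simp add: has_vector_derivative_def mult.assoc)
  qed
  have double: "F (2 *\<^sub>R (G o\<^sub>L B)) = 2 * F (G o\<^sub>L B)" if "(f has_derivative F) (at G within gen_metrics)" for F
    using linear_cmul[OF has_derivative_linear[OF that], of 2] by simp
  have "D (2 *\<^sub>R (G o\<^sub>L B)) = D' (2 *\<^sub>R (G o\<^sub>L B))"
    by (rule vector_derivative_unique_within[OF _ *[OF D] *[OF D']])
      (use d in \<open>simp add: at_within_Icc_at_right trivial_limit_at_right_real\<close>)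
  then show ?thesis using double[OF D] double[OF D'] by simp
qed

text \<open>Two gradients have the same products with all tangent vectors, in particular with their own
  difference, and the symmetric metric is definite.\<close>

lemma sym_gradient_unique:
  assumes G: "G \<in> gen_metrics" and A: "has_sym_gradient f G A" and A': "has_sym_gradient f G A'"
  shows "A = A'"
proof -
  obtain g b where "inner_product g" "two_form b" and Ggb: "G = gen_metric_of g b"
    using gen_metric_exists[OF G] by blast
  then interpret metric_b_pair g b by unfold_locales
  obtain D D' where D: "(f has_derivative D) (at G within gen_metrics)"
      "\<And>B. B \<in> tangent_endos G \<Longrightarrow> sym_metric A B = D (G o\<^sub>L B)"
    and D': "(f has_derivative D') (at G within gen_metrics)"
      "\<And>B. B \<in> tangent_endos G \<Longrightarrow> sym_metric A' B = D' (G o\<^sub>L B)"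
    using A A' unfolding has_sym_gradient_def by blast
  have mem: "A \<in> tangent_endos G" "A' \<in> tangent_endos G"
    using A A' by (auto simp: has_sym_gradient_def)
  have t: "A - A' \<in> tangent_endos G"
  proof -
    have "pairing (C u) v = - pairing u (C v)" "gen_inner G (C u) v = gen_inner G u (C v)"
      if "C \<in> tangent_endos G" for C u v
      using that by (simp_all add: tangent_endos_def eq_neg_iff_add_eq_0 del: split_paired_All)
    from this[OF mem(1)] this[OF mem(2)] show ?thesis
      by (simp add: tangent_endos_def gen_inner_def blinfun.diff_left blinfun.diff_right pairing_diff
        del: split_paired_All)
  qed
  have "sym_metric (A - A') B = sym_metric A B - sym_metric A' B" for B
    by (simp add: sym_metric_def endo_trace_def blinfun.diff_left inner_diff_left sum_subtractf)
  then have "sym_metric (A - A') (A - A') = 0"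
    using D(2)[OF t] D'(2)[OF t] derivative_on_tangents_unique[OF G t D(1) D'(1)] by simp
  then show ?thesis using sym_metric_definite t unfolding Ggb by fastforce
qed

section \<open>The generalized Ricci curvature as a tangent vector\<close>

lemma dual_op_apply: "blinfun_apply (dual_op R) \<xi> = \<xi> o\<^sub>L R"
  unfolding dual_op_def
  by (rule fun_cong[OF bounded_linear_Blinfun_apply])
    (rule bounded_bilinear.bounded_linear_left[OF bounded_bilinear_blinfun_compose])

locale gen_metric_on_lie = metric_b_pair g b + unimodular_metric g mu
  for g :: "'a::euclidean_space \<Rightarrow> 'a \<Rightarrow> real" and b :: "'a \<Rightarrow> 'a \<Rightarrow> real"
    and mu :: "'a \<Rightarrow> 'a \<Rightarrow> 'a" +
  fixes H :: "'a \<Rightarrow> 'a \<Rightarrow> 'a \<Rightarrow> real"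
  assumes H: "three_form H"
begin

abbreviation G :: "'a endo" where "G \<equiv> gen_metric_of g b"

definition F :: "'a \<Rightarrow> 'a \<Rightarrow> 'a \<Rightarrow> real" where
  "F X Y Z = H X Y Z + d2 mu b X Y Z"

lemma F_three_form: "three_form F"
proof -
  have "three_form (d2 mu b)" by (rule d2_three_form[OF mu mu_alt b])
  with H show ?thesis unfolding three_form_def F_def bilinear_def
    by (auto intro: linear_compose_add)
qed

lemma H_of_eq: "H_of mu H G = F"
  by (intro ext) (simp add: H_of_def F_def metric_b_field_gen_metric_of[OF inner b])

definition ric_form :: "'a \<Rightarrow> 'a \<Rightarrow> real" where
  "ric_form X Y = ricci mu g X Y - square3 g F X Y / 4"

definition ric_op :: "'a \<Rightarrow> 'a" where "ric_op X = sharp_op g (flat_op ric_form X)"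

definition codiff_op :: "'a \<Rightarrow> 'a" where "codiff_op X = sharp_op g (flat_op (codiff3 mu g F) X)"

lemma ric_form_bilinear: "bilinear ric_form"
  using ricci_bilinear
  unfolding ric_form_def square3_def bilinear_def
  by (auto intro!: linear_compose_sub linearI simp: bilin_simps[OF ricci_bilinear] bilin_simps[OF three_form_multilinear(2)[OF F_three_form]]
      sum.distrib algebra_simps sum_distrib_left add_divide_distrib sum_divide_distrib)

lemma ric_form_sym: "ric_form X Y = ric_form Y X"
  by (simp add: ric_form_def ricci_sym[of X] square3_def mult.commute)

lemma g_ric_op: "g (ric_op X) Y = ric_form X Y"
  by (simp add: ric_op_def g_sharp flat_op_apply[OF ric_form_bilinear])

lemma g_codiff_op: "g (codiff_op X) Y = codiff3 mu g F X Y"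
  using codiff3_two_form[OF F_three_form] by (simp add: codiff_op_def g_sharp flat_op_apply two_form_def)

lemma linear_ric_op: "linear ric_op" and linear_codiff_op: "linear codiff_op"
  unfolding ric_op_def codiff_op_def
  by (intro linearI; simp add: blinfun.add_right blinfun.scaleR_right)+

text \<open>The generalized Ricci curvature is itself a tangent vector; the symmetry of its diagonal block is
  that of the Ricci tensor.\<close>

lemma gen_ricci_blocks: "tangent_blocks ric_op (\<lambda>X. (1/2) *\<^sub>R codiff_op X) (gen_ricci mu H G)"
  unfolding tangent_blocks_def
proof (intro conjI allI)
  show "linear ric_op" by (rule linear_ric_op)
  show "linear (\<lambda>X. (1/2) *\<^sub>R codiff_op X)" using linear_codiff_op by (rule linear_compose_scale_right)
  show ric_op_sym: "g (ric_op X) Y = g X (ric_op Y)" for X Y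
    by (simp add: sym[of X] g_ric_op ric_form_sym[of X])
  show "g ((1/2) *\<^sub>R codiff_op X) Y = - g X ((1/2) *\<^sub>R codiff_op Y)" for X Y
    using two_form_skew[OF codiff3_two_form[OF F_three_form], of X Y] by (simp add: g_simps sym[of X] g_codiff_op)
  have dual: "dual_op (sharp_op g o\<^sub>L flat_op ric_form) (flat_op g Y) = flat_op g (ric_op Y)" for Y
    by (rule blinfun_eqI)
      (simp add: dual_op_apply flat_op_apply[OF g_bilinear] ric_op_sym flip: ric_op_def)
  have flat_codiff_op: "flat_op (codiff3 mu g F) X = flat_op g (codiff_op X)" for X
    by (simp add: codiff_op_def)
  fix X Y
  have f0: "flat_op (\<lambda>X Y. ricci mu g X Y - square3 g F X Y / 4) = flat_op ric_form"
    by (simp add: ric_form_def[abs_def])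
  show "blinfun_apply (gen_ricci mu H G) (frame X Y) =
    frame (ric_op X + (1/2) *\<^sub>R codiff_op Y) (- ((1/2) *\<^sub>R codiff_op X) - ric_op Y)"
    unfolding gen_ricci_def Let_def H_of_eq metric_b_field_gen_metric_of[OF inner b] fst_conv snd_conv f0
    by (simp add: frame_def exp_b_apply flat_op_uminus[OF b_bilinear] block_op_apply dual
        blinfun.add_left blinfun.minus_left blinfun.scaleR_left blinfun.diff_right blinfun.minus_right
        blinfun.add_right blinfun.scaleR_right flat_codiff_op flip: ric_op_def)
qed

end

section \<open>Differentiating the metric and the 2-form\<close>

text \<open>A product with a factor that vanishes at \<open>x\<close> is differentiable there as soon as the other factor
  is continuous (Caratheodory).\<close>

lemma has_derivative_vanishing_mult:
  fixes l q :: "'v::real_normed_vector \<Rightarrow> real"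
  assumes l: "bounded_linear l" and q: "(q \<longlongrightarrow> q x) (at x within S)"
  shows "((\<lambda>y. l (y - x) * q y) has_derivative (\<lambda>v. l v * q x)) (at x within S)"
proof -
  obtain K where K: "\<And>v. norm (l v) \<le> norm v * K" using bounded_linear.bounded[OF l] by blast
  show ?thesis
  proof (rule has_derivativeI_sandwich[where e = 1 and H = "\<lambda>y. K * \<bar>q y - q x\<bar>"])
    show "bounded_linear (\<lambda>v. l v * q x)" by (intro bounded_linear_intros l)
    have "((\<lambda>y. K * \<bar>q y - q x\<bar>) \<longlongrightarrow> K * \<bar>q x - q x\<bar>) (at x within S)"
      by (intro tendsto_intros q)
    then show "((\<lambda>y. K * \<bar>q y - q x\<bar>) \<longlongrightarrow> 0) (at x within S)" by simp
    fix y assume "y \<noteq> x"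
    have "norm (l (y - x) * q y - l (x - x) * q x - l (y - x) * q x) = norm (l (y - x)) * \<bar>q y - q x\<bar>"
      using bounded_linear.linear[OF l]
      by (simp add: linear_0 abs_mult flip: right_diff_distrib)
    also have "\<dots> \<le> norm (y - x) * K * \<bar>q y - q x\<bar>"
      by (intro mult_right_mono K) simp
    finally show "norm (l (y - x) * q y - l (x - x) * q x - l (y - x) * q x) / norm (y - x)
        \<le> K * \<bar>q y - q x\<bar>"
      using \<open>y \<noteq> x\<close> by (simp add: divide_simps mult_ac)
  qed simp
qed

lemma contraction_at_delta:
  fixes f :: "'e \<Rightarrow> 'e \<Rightarrow> real"
  assumes "finite I" "\<And>a l. a \<in> I \<Longrightarrow> l \<in> I \<Longrightarrow> k a l = (if a = l then 1 else 0)"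
  shows "(\<Sum>a\<in>I. \<Sum>l\<in>I. k a l * f a l) = (\<Sum>a\<in>I. f a a)"
proof (rule sum.cong[OF refl])
  fix a assume a: "a \<in> I"
  have "(\<Sum>l\<in>I. k a l * f a l) = (\<Sum>l\<in>I. (if a = l then 1 else 0) * f a l)"
    using assms(2)[OF a] by (intro sum.cong) auto
  then show "(\<Sum>l\<in>I. k a l * f a l) = f a a"
    using sum_mult_delta(2)[OF assms(1) a, of "f a"] by simp
qed

text \<open>Product rule for a metric contraction at a point where the contracting coefficients are the
  identity. Nested contractions are differentiated by applying it once for each pair of indices.\<close>

lemma contraction_has_derivative:
  fixes f :: "'e \<Rightarrow> 'e \<Rightarrow> 'v::real_normed_vector \<Rightarrow> real"
  assumes fin: "finite I"
    and delta: "\<And>a l. a \<in> I \<Longrightarrow> l \<in> I \<Longrightarrow> k a l x = (if a = l then 1 else 0)"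
    and k: "\<And>a l. (k a l has_derivative \<kappa> a l) (at x within S)"
    and f: "\<And>a l. (f a l has_derivative \<phi> a l) (at x within S)"
  shows "((\<lambda>y. \<Sum>a\<in>I. \<Sum>l\<in>I. k a l y * f a l y) has_derivative
    (\<lambda>v. (\<Sum>a\<in>I. \<Sum>l\<in>I. \<kappa> a l v * f a l x) + (\<Sum>a\<in>I. \<phi> a a v))) (at x within S)"
proof -
  have "((\<lambda>y. \<Sum>a\<in>I. \<Sum>l\<in>I. k a l y * f a l y) has_derivative
    (\<lambda>v. \<Sum>a\<in>I. \<Sum>l\<in>I. k a l x * \<phi> a l v + \<kappa> a l v * f a l x)) (at x within S)"
    by (intro has_derivative_sum has_derivative_mult k f)
  moreover have "(\<Sum>a\<in>I. \<Sum>l\<in>I. k a l x * \<phi> a l v) = (\<Sum>a\<in>I. \<phi> a a v)" for v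
    by (rule contraction_at_delta[OF fin delta])
  ultimately show ?thesis by (simp add: sum.distrib add.commute)
qed

lemma (in metric) sum_contract: "bilinear f \<Longrightarrow> (\<Sum>a\<in>E. \<Sum>l\<in>E. g a (P l) * f a l) = (\<Sum>l\<in>E. (f (P l) l :: real))"
proof -
  assume f: "bilinear f"
  have "f (P l) l = (\<Sum>a\<in>E. g a (P l) * f a l)" for l
    using expand_linear[OF bilinear_linear(2)[OF f], of "P l" l] by (simp add: sym)
  then show ?thesis by (subst sum.swap) simp
qed

text \<open>The upper right block of a generalized metric is its inverse metric. Here it is precomposed with a
  fixed metric \<open>g\<close> so that it acts on the Lie algebra.\<close>

definition upper_right :: "('a::euclidean_space \<Rightarrow> 'a \<Rightarrow> real) \<Rightarrow> 'a endo \<Rightarrow> 'a \<Rightarrow> 'a" where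
  "upper_right g V X = fst (blinfun_apply V (0, flat_op g X))"

definition upper_left :: "'a::euclidean_space endo \<Rightarrow> 'a \<Rightarrow> 'a" where
  "upper_left V X = fst (blinfun_apply V (X, 0))"

abbreviation metric_of :: "'a::euclidean_space endo \<Rightarrow> 'a \<Rightarrow> 'a \<Rightarrow> real" where
  "metric_of G \<equiv> fst (metric_b_field G)"

abbreviation b_of :: "'a::euclidean_space endo \<Rightarrow> 'a \<Rightarrow> 'a \<Rightarrow> real" where
  "b_of G \<equiv> snd (metric_b_field G)"

lemma metric_b_field_props:
  assumes "G \<in> gen_metrics"
  shows "metric_b_pair (metric_of G) (b_of G)" "G = gen_metric_of (metric_of G) (b_of G)"
proof -
  obtain g b where gb: "inner_product g" "two_form b" "G = gen_metric_of g b"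
    using gen_metric_exists[OF assms] by blast
  have "metric_b_field G = (g, b)" unfolding gb(3) using gb(1,2) by (rule metric_b_field_gen_metric_of)
  then show "metric_b_pair (metric_of G) (b_of G)" "G = gen_metric_of (metric_of G) (b_of G)"
    using gb by (simp_all add: metric_b_pair_def metric_def metric_b_pair_axioms_def)
qed

context metric_b_pair begin

lemma upper_right_gen_metric: "fst (blinfun_apply (gen_metric_of g b) (0, \<xi>)) = sharp_op g \<xi>"
  by (simp add: gen_metric_of_apply[OF b_bilinear])

lemma g_upper_left: "g (upper_left (gen_metric_of g b) X) Y = - b X Y"
  by (simp add: upper_left_def gen_metric_of_apply[OF b_bilinear] blinfun.minus_right g_simps
      g_b_sharp flip: b_sharp_def)

text \<open>A priori bound: \<open>2 \<langle>G (X,0), (X,0)\<rangle> = g X X + |g\<^sup>-\<^sup>1 b X|\<^sup>2\<close>. It makes \<open>metric_of\<close> locally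
  bounded, although \<open>metric_of\<close> is the inverse of a block of its argument.\<close>

lemma g_le_norm_gen_metric: "\<bar>g X Y\<bar> \<le> norm (gen_metric_of g b) * ((norm X)\<^sup>2 + (norm Y)\<^sup>2)"
proof -
  let ?G = "gen_metric_of g b"
  have diag: "g X X \<le> norm ?G * (norm X)\<^sup>2" for X
  proof -
    have X: "(X, 0) = frame X (- b_sharp X)"
      by (simp add: frame_def b_sharp_def blinfun.minus_right)
    have "g X X \<le> 2 * pairing (?G (X, 0)) (X, 0)"
      unfolding X gen_metric_frame pairing_frame using nonneg[of "b_sharp X"] by (simp add: g_simps)
    also have "\<dots> = blinfun_apply (snd (blinfun_apply ?G (X, 0))) X" by (simp add: pairing_eq)
    also have "\<dots> \<le> norm (snd (blinfun_apply ?G (X, 0))) * norm X"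
      using norm_blinfun[of "snd (blinfun_apply ?G (X, 0))" X] by simp
    also have "\<dots> \<le> (norm ?G * norm X) * norm X"
    proof (intro mult_right_mono)
      have "norm (snd (blinfun_apply ?G (X, 0))) \<le> norm (blinfun_apply ?G (X, 0))"
        by (metis norm_snd_le prod.collapse)
      also have "\<dots> \<le> norm ?G * norm (X, 0 :: 'a dual)" by (rule norm_blinfun)
      finally show "norm (snd (blinfun_apply ?G (X, 0))) \<le> norm ?G * norm X" by (simp add: norm_Pair)
    qed simp
    finally show ?thesis by (simp add: power2_eq_square mult.assoc)
  qed
  have "g (X + Y) (X + Y) \<ge> 0" "g (X - Y) (X - Y) \<ge> 0" by (rule nonneg)+
  then have "2 * \<bar>g X Y\<bar> \<le> g X X + g Y Y" by (simp add: g_simps sym[of Y X] abs_le_iff)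
  with diag[of X] diag[of Y] nonneg[of X] nonneg[of Y] show ?thesis by (simp add: algebra_simps)
qed

lemma bounded_linear_upper_right: "bounded_linear (\<lambda>V. g (upper_right g V X) Y)"
  and bounded_linear_upper_left: "bounded_linear (\<lambda>V. g (upper_left V X) Y)"
proof -
  have g: "bounded_linear (\<lambda>Z. g Z Y)"
    using bilinear_linear(2)[OF g_bilinear] by (simp add: linear_conv_bounded_linear)
  have "bounded_linear (\<lambda>V :: 'a endo. fst (blinfun_apply V u))" for u
    by (intro bounded_linear_intros bounded_linear_compose[OF bounded_linear_fst] blinfun.bounded_linear_left)
  from bounded_linear_compose[OF g this]
  show "bounded_linear (\<lambda>V. g (upper_right g V X) Y)" "bounded_linear (\<lambda>V. g (upper_left V X) Y)"
    by (simp_all add: upper_right_def upper_left_def)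
qed

text \<open>The resolvent identity \<open>g\<^sub>1 - g = - g\<^sub>1 (g\<^sub>1\<^sup>-\<^sup>1 - g\<^sup>-\<^sup>1) g\<close>: the increment of the metric is linear in the
  increment of the generalized metric, with coefficients that are values of the metric itself. With
  the a priori bound this gives continuity, and continuity gives differentiability.\<close>

lemma metric_of_increment:
  assumes G': "G' \<in> gen_metrics"
  shows "metric_of G' X Y - g X Y =
    - (\<Sum>e\<in>E. g (upper_right g (G' - gen_metric_of g b) X) e * metric_of G' e Y)"
proof -
  interpret G': metric_b_pair "metric_of G'" "b_of G'" by (rule metric_b_field_props(1)[OF G'])
  have "upper_right g G' X = sharp_op (metric_of G') (flat_op g X)"
    using G'.upper_right_gen_metric metric_b_field_props(2)[OF G'] by (simp add: upper_right_def)
  then have "metric_of G' (upper_right g (G' - gen_metric_of g b) X) Y = g X Y - metric_of G' X Y"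
    by (simp add: upper_right_def blinfun.diff_left upper_right_gen_metric G'.g_simps G'.g_sharp flat_op_apply[OF g_bilinear])
  then show ?thesis
    using expand_linear[OF bilinear_linear(2)[OF G'.g_bilinear], of "upper_right g (G' - gen_metric_of g b) X" Y]
    by simp
qed

lemma metric_of_tendsto:
  "((\<lambda>G'. metric_of G' X Y) \<longlongrightarrow> g X Y) (at (gen_metric_of g b) within gen_metrics)"
proof -
  let ?F = "at (gen_metric_of g b) within gen_metrics"
  let ?l = "\<lambda>e G'. g (upper_right g (G' - gen_metric_of g b) X) e"
  have term0: "((\<lambda>G'. ?l e G' * metric_of G' e Y) \<longlongrightarrow> 0) ?F" for e
  proof (rule Lim_null_comparison)
    show "\<forall>\<^sub>F G' in ?F. norm (?l e G' * metric_of G' e Y)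
        \<le> \<bar>?l e G'\<bar> * (norm G' * ((norm e)\<^sup>2 + (norm Y)\<^sup>2))"
      unfolding eventually_at_filter
    proof (intro always_eventually allI impI)
      fix G' :: "'a endo" assume G': "G' \<in> gen_metrics"
      show "norm (?l e G' * metric_of G' e Y)
        \<le> \<bar>?l e G'\<bar> * (norm G' * ((norm e)\<^sup>2 + (norm Y)\<^sup>2))"
        using metric_b_pair.g_le_norm_gen_metric[OF metric_b_field_props(1)[OF G'], of e Y]
        by (simp add: abs_mult mult_left_mono flip: metric_b_field_props(2)[OF G'])
    qed
    have "((\<lambda>G'. G' - gen_metric_of g b) \<longlongrightarrow> 0) ?F"
      by (rule tendsto_eq_intros refl tendsto_ident_at | simp)+
    then have "((\<lambda>G'. ?l e G') \<longlongrightarrow> 0) ?F"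
      by (rule bounded_linear.tendsto_zero[OF bounded_linear_upper_right])
    then have "((\<lambda>G'. \<bar>?l e G'\<bar> * (norm G' * ((norm e)\<^sup>2 + (norm Y)\<^sup>2))) \<longlongrightarrow>
        \<bar>0\<bar> * (norm (gen_metric_of g b) * ((norm e)\<^sup>2 + (norm Y)\<^sup>2))) ?F"
      by (intro tendsto_intros)
    then show "((\<lambda>G'. \<bar>?l e G'\<bar> * (norm G' * ((norm e)\<^sup>2 + (norm Y)\<^sup>2))) \<longlongrightarrow> 0) ?F" by simp
  qed
  have "((\<lambda>G'. g X Y + - (\<Sum>e\<in>E. ?l e G' * metric_of G' e Y)) \<longlongrightarrow> g X Y + - (\<Sum>e\<in>E. 0)) ?F"
    by (intro tendsto_intros term0)
  then have "((\<lambda>G'. g X Y - (\<Sum>e\<in>E. ?l e G' * metric_of G' e Y)) \<longlongrightarrow> g X Y) ?F" by simp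
  moreover have "\<forall>\<^sub>F G' in ?F. g X Y - (\<Sum>e\<in>E. ?l e G' * metric_of G' e Y) = metric_of G' X Y"
    unfolding eventually_at_filter
    by (intro always_eventually allI impI) (use metric_of_increment in \<open>force simp: algebra_simps\<close>)
  ultimately show ?thesis by (rule Lim_transform_eventually)
qed

lemma metric_of_base: "metric_of (gen_metric_of g b) = g" "b_of (gen_metric_of g b) = b"
  by (simp_all add: metric_b_field_gen_metric_of[OF inner b])

text \<open>Derivative of \<open>g\<close> when the generalized metric moves with velocity \<open>V\<close>: minus that of
  the inverse, with indices lowered.\<close>

definition dmetric :: "'a \<Rightarrow> 'a \<Rightarrow> 'a endo \<Rightarrow> real" where
  "dmetric X Y V = - g (upper_right g V X) Y"

lemma metric_of_has_derivative:
  "((\<lambda>G'. metric_of G' X Y) has_derivative dmetric X Y) (at (gen_metric_of g b) within gen_metrics)"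
proof -
  let ?G = "gen_metric_of g b"
  let ?f = "\<lambda>G'. g X Y - (\<Sum>e\<in>E. g (upper_right g (G' - ?G) X) e * metric_of G' e Y)"
  have "(?f has_derivative (\<lambda>V. 0 - (\<Sum>e\<in>E. g (upper_right g V X) e * metric_of ?G e Y)))
      (at ?G within gen_metrics)"
    by (intro has_derivative_diff has_derivative_const has_derivative_sum
        has_derivative_vanishing_mult bounded_linear_upper_right)
      (simp add: metric_of_base metric_of_tendsto)
  moreover have "(\<lambda>V. 0 - (\<Sum>e\<in>E. g (upper_right g V X) e * metric_of ?G e Y)) = dmetric X Y"
  proof
    fix V show "0 - (\<Sum>e\<in>E. g (upper_right g V X) e * metric_of ?G e Y) = dmetric X Y V"
      using expand_linear[OF bilinear_linear(2)[OF g_bilinear], of "upper_right g V X" Y]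
      by (simp add: metric_of_base dmetric_def)
  qed
  ultimately have "(?f has_derivative dmetric X Y) (at ?G within gen_metrics)"
    by (simp only:)
  then show ?thesis
    by (rule has_derivative_transform[rotated 2])
      (use metric_of_increment gen_metric_of_mem in \<open>force simp: algebra_simps\<close>)+
qed

lemma b_of_eq:
  assumes G': "G' \<in> gen_metrics"
  shows "b_of G' X Y = - (\<Sum>e\<in>E. g (upper_left G' X) e * metric_of G' e Y)"
proof -
  interpret G': metric_b_pair "metric_of G'" "b_of G'" by (rule metric_b_field_props(1)[OF G'])
  have "metric_of G' (upper_left G' X) Y = - b_of G' X Y"
    using G'.g_upper_left metric_b_field_props(2)[OF G'] by simp
  then show ?thesis
    using expand_linear[OF bilinear_linear(2)[OF G'.g_bilinear], of "upper_left G' X" Y] by simp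
qed

text \<open>Derivative of the 2-form \<open>b\<close> when the generalized metric moves with velocity \<open>V\<close>, from
  the product rule applied to \<open>b = - g L\<close> with \<open>L\<close> the upper left block.\<close>

definition db_field :: "'a \<Rightarrow> 'a \<Rightarrow> 'a endo \<Rightarrow> real" where
  "db_field X Y V = - (\<Sum>e\<in>E. g (upper_left (gen_metric_of g b) X) e * dmetric e Y V
     + g (upper_left V X) e * g e Y)"

lemma b_of_has_derivative:
  "((\<lambda>G'. b_of G' X Y) has_derivative db_field X Y) (at (gen_metric_of g b) within gen_metrics)"
proof -
  let ?G = "gen_metric_of g b"
  have "((\<lambda>G'. - (\<Sum>e\<in>E. g (upper_left G' X) e * metric_of G' e Y)) has_derivative
      (\<lambda>V. - (\<Sum>e\<in>E. g (upper_left ?G X) e * dmetric e Y V + g (upper_left V X) e * metric_of ?G e Y)))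
      (at ?G within gen_metrics)"
    by (intro has_derivative_minus has_derivative_sum has_derivative_mult metric_of_has_derivative
        bounded_linear_imp_has_derivative bounded_linear_upper_left)
  then have "((\<lambda>G'. - (\<Sum>e\<in>E. g (upper_left G' X) e * metric_of G' e Y)) has_derivative db_field X Y)
      (at ?G within gen_metrics)"
    by (simp add: metric_of_base db_field_def[abs_def])
  then show ?thesis
    by (rule has_derivative_transform[rotated 2]) (simp_all add: b_of_eq gen_metric_of_mem)
qed

text \<open>A tangent vector with blocks \<open>P\<close> and \<open>Q\<close> moves \<open>g\<close> by \<open>g P\<close> and \<open>b\<close> by \<open>g Q\<close>. The dependence on the
  value of \<open>b\<close> at the base point cancels in the second formula, between the variation of \<open>g\<close> and that
  of the upper left block \<open>- g\<^sup>-\<^sup>1 b\<close>.\<close>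

lemma
  assumes B: "tangent_blocks P Q B"
  shows upper_right_tangent: "upper_right g (gen_metric_of g b o\<^sub>L B) X = - P X"
    and dmetric_tangent: "dmetric X Y (gen_metric_of g b o\<^sub>L B) = g (P X) Y"
    and db_field_tangent: "db_field X Y (gen_metric_of g b o\<^sub>L B) = g (Q X) Y"
proof -
  let ?V = "gen_metric_of g b o\<^sub>L B"
  have lin: "linear P" "linear Q" using B by (auto simp: tangent_blocks_def)
  have Bf: "blinfun_apply B (frame X Y) = frame (P X + Q Y) (- Q X - P Y)" for X Y
    using B by (simp add: tangent_blocks_def)
  have fst_frame: "fst (frame X Y) = X" for X Y by (simp add: frame_def)
  have "(0, flat_op g X) = frame 0 X" for X by (simp add: frame_def)
  then show ur: "upper_right g ?V X = - P X" for X
    by (simp add: upper_right_def Bf gen_metric_frame linear_0 lin fst_frame)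
  then show dm: "dmetric X Y ?V = g (P X) Y" for X Y by (simp add: dmetric_def g_simps)
  have "(X, 0) = frame X (- b_sharp X)"
    by (simp add: frame_def b_sharp_def blinfun.minus_right)
  then have ul: "upper_left ?V X = P (b_sharp X) - Q X"
    by (simp add: upper_left_def Bf gen_metric_frame linear_neg lin fst_frame)
  have ulG: "g (upper_left (gen_metric_of g b) X) e = - g (b_sharp X) e" for e
    by (simp add: g_upper_left g_b_sharp)
  have "linear (\<lambda>Z. g (P Z) Y)" using lin by (intro linearI) (simp_all add: linear_add linear_cmul g_simps)
  from expand_linear[OF this, of "b_sharp X"] expand_linear[OF bilinear_linear(2)[OF g_bilinear], of "P (b_sharp X) - Q X" Y]
  show "db_field X Y ?V = g (Q X) Y"
    by (simp add: db_field_def dm ul ulG sum.distrib sum_negf sum_subtractf g_simps)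
qed

end

section \<open>The first variation of the generalized scalar curvature\<close>

context gen_metric_on_lie begin

text \<open>The inverse metric of a generalized metric, in coefficients with respect to the frame \<open>E\<close> of the
  base metric \<open>g\<close>. These depend linearly on the generalized metric and are the identity at the
  base point.\<close>

definition ginv :: "'a \<Rightarrow> 'a \<Rightarrow> 'a endo \<Rightarrow> real" where
  "ginv a l V = g a (upper_right g V l)"

lemma ginv_bounded_linear: "bounded_linear (ginv a l)"
  using bounded_linear_upper_right by (simp add: ginv_def[abs_def] sym[of a])

lemma ginv_has_derivative: "(ginv a l has_derivative ginv a l) (at G within gen_metrics)"
  by (rule bounded_linear_imp_has_derivative[OF ginv_bounded_linear])

lemma ginv_delta: "a \<in> E \<Longrightarrow> l \<in> E \<Longrightarrow> ginv a l G = (if a = l then 1 else 0)"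
  by (simp add: ginv_def upper_right_def upper_right_gen_metric ortho)

lemma ginv_at_base: "(\<Sum>a\<in>E. \<Sum>l\<in>E. ginv a l G * f a l) = (\<Sum>a\<in>E. (f a a :: real))"
  by (rule contraction_at_delta[OF fin ginv_delta])

lemma unimodular_metric_of:
  assumes "G' \<in> gen_metrics" shows "unimodular_metric (metric_of G') mu"
  using metric_b_field_props(1)[OF assms] unimodular_metric_axioms
  by (simp add: metric_b_pair_def unimodular_metric_def left_invariant_metric_def
      unimodular_metric_axioms_def left_invariant_metric_axioms_def)

lemma contraction_metric_of:
  assumes G': "G' \<in> gen_metrics" and f: "bilinear f"
  shows "(\<Sum>e\<in>onb (metric_of G'). f e e) = (\<Sum>a\<in>E. \<Sum>l\<in>E. ginv a l G' * (f a l :: real))"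
proof -
  interpret G': metric_b_pair "metric_of G'" "b_of G'" by (rule metric_b_field_props(1)[OF G'])
  have "upper_right g G' l = sharp_op (metric_of G') (flat_op g l)" for l
    using G'.upper_right_gen_metric metric_b_field_props(2)[OF G'] by (simp add: upper_right_def)
  then show ?thesis
    unfolding ginv_def by (simp add: inverse_metric_contraction[OF G'.metric_axioms f])
qed

definition killing :: "'a \<Rightarrow> 'a \<Rightarrow> real" where
  "killing X Y = lin_trace (\<lambda>Z. mu X (mu Y Z))"

lemma killing_bilinear: "bilinear killing"
  unfolding bilinear_def killing_def lin_trace_def
  by (intro conjI allI linearI) (simp_all add: mu_simps inner_add_left sum.distrib sum_distrib_left)

lemma scal_metric_of:
  assumes G': "G' \<in> gen_metrics"
  shows "scal mu (metric_of G') =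
    - (\<Sum>a\<in>E. \<Sum>l\<in>E. ginv a l G' * (\<Sum>c\<in>E. \<Sum>m\<in>E. ginv c m G' * metric_of G' (mu a c) (mu l m))) / 4
    - (\<Sum>a\<in>E. \<Sum>l\<in>E. ginv a l G' * killing a l) / 2"
proof -
  interpret G': unimodular_metric "metric_of G'" mu by (rule unimodular_metric_of[OF G'])
  have in1: "bilinear (\<lambda>x y. metric_of G' (mu a x) (mu l y))" for a l
    unfolding bilinear_def by (intro conjI allI linearI) (simp_all add: G'.g_simps mu_simps)
  have in2: "bilinear (\<lambda>x y. metric_of G' (mu x a) (mu y l))" for a l
    unfolding bilinear_def by (intro conjI allI linearI) (simp_all add: G'.g_simps mu_simps)
  have out: "bilinear (\<lambda>x y. \<Sum>j\<in>onb (metric_of G'). metric_of G' (mu x j) (mu y j))"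
    by (rule bilinear_sum_fun) (rule in2)
  show ?thesis
    unfolding G'.scal_formula killing_def[symmetric] contraction_metric_of[OF G' killing_bilinear]
      contraction_metric_of[OF G' out]
    unfolding contraction_metric_of[OF G' in1] ..
qed

lemma sum_contraction_swap:
  "(\<Sum>a\<in>E. \<Sum>c\<in>E. \<Sum>m\<in>E. k c m * f a c m) = (\<Sum>c\<in>E. \<Sum>m\<in>E. k c m * (\<Sum>a\<in>E. (f a c m :: real)))"
  by (subst sum.swap, rule sum.cong[OF refl], subst sum.swap) (simp add: sum_distrib_left)

text \<open>The first variation of the scalar curvature. For left-invariant metrics on a unimodular group
  the divergence terms are absent and only \<open>- \<langle>Ric, h\<rangle>\<close> is left. Of \<open>scal_formula\<close>, the two
  contractions with the inverse metric and the Killing term contribute \<open>N\<close> and \<open>killing\<close>, and the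
  metric applied to brackets contributes the remaining term of \<open>ricci_formula\<close>.\<close>

lemma scal_has_derivative:
  "\<exists>D. ((\<lambda>G'. scal mu (metric_of G')) has_derivative D) (at G within gen_metrics) \<and>
    (\<forall>P Q B. tangent_blocks P Q B \<longrightarrow> D (G o\<^sub>L B) = - (\<Sum>l\<in>E. ricci mu g (P l) l))"
proof -
  let ?f = "\<lambda>G'. - (\<Sum>a\<in>E. \<Sum>l\<in>E. ginv a l G' *
      (\<Sum>c\<in>E. \<Sum>m\<in>E. ginv c m G' * metric_of G' (mu a c) (mu l m))) / 4
    - (\<Sum>a\<in>E. \<Sum>l\<in>E. ginv a l G' * killing a l) / 2"
  define D where "D V = - ((\<Sum>a\<in>E. \<Sum>l\<in>E. ginv a l V *
        (\<Sum>c\<in>E. \<Sum>m\<in>E. ginv c m G * metric_of G (mu a c) (mu l m))) +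
      (\<Sum>a\<in>E. (\<Sum>c\<in>E. \<Sum>m\<in>E. ginv c m V * metric_of G (mu a c) (mu a m)) +
        (\<Sum>c\<in>E. dmetric (mu a c) (mu a c) V))) / 4
      - ((\<Sum>a\<in>E. \<Sum>l\<in>E. ginv a l V * killing a l) + (\<Sum>a\<in>E. 0)) / 2" for V
  have "(?f has_derivative D) (at G within gen_metrics)"
    unfolding D_def[abs_def]
    by (intro has_derivative_diff has_derivative_minus bounded_linear.has_derivative[OF bounded_linear_divide]
      contraction_has_derivative[OF fin ginv_delta ginv_has_derivative]
      metric_of_has_derivative has_derivative_const)
  then have "((\<lambda>G'. scal mu (metric_of G')) has_derivative D) (at G within gen_metrics)"
    by (rule has_derivative_transform[rotated 2]) (simp_all add: scal_metric_of gen_metric_of_mem)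
  moreover have "D (G o\<^sub>L B) = - (\<Sum>l\<in>E. ricci mu g (P l) l)" if B: "tangent_blocks P Q B" for P Q B
  proof -
    have lin: "linear P" using B by (simp add: tangent_blocks_def)
    have \<kappa>: "ginv a l (G o\<^sub>L B) = - g a (P l)" for a l
      by (simp add: ginv_def upper_right_tangent[OF B] g_simps)
    define N where "N X Y = (\<Sum>c\<in>E. g (mu c X) (mu c Y))" for X Y
    have N: "bilinear N" unfolding N_def
      by (rule bilinear_sum_fun) (unfold bilinear_def, intro conjI allI linearI, simp_all add: g_simps mu_simps)
    have 1: "(\<Sum>a\<in>E. \<Sum>l\<in>E. ginv a l (G o\<^sub>L B) *
        (\<Sum>c\<in>E. \<Sum>m\<in>E. ginv c m G * metric_of G (mu a c) (mu l m))) = - (\<Sum>l\<in>E. N (P l) l)"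
    proof -
      have "(\<Sum>c\<in>E. g (mu a c) (mu l c)) = N a l" for a l
        unfolding N_def by (intro sum.cong refl) (simp add: mu_skew[of a] mu_skew[of l] g_simps)
      then show ?thesis
        by (simp add: ginv_at_base metric_of_base \<kappa> sum_negf sum_contract[OF N])
    qed
    have 2: "(\<Sum>a\<in>E. \<Sum>c\<in>E. \<Sum>m\<in>E. ginv c m (G o\<^sub>L B) * metric_of G (mu a c) (mu a m))
        = - (\<Sum>l\<in>E. N (P l) l)"
      unfolding sum_contraction_swap
      by (simp add: metric_of_base \<kappa> sum_negf sum_contract[OF N] flip: N_def)
    have 3: "(\<Sum>a\<in>E. \<Sum>l\<in>E. ginv a l (G o\<^sub>L B) * killing a l) = - (\<Sum>l\<in>E. killing (P l) l)"
      by (simp add: \<kappa> sum_negf sum_contract[OF killing_bilinear])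
    have 4: "(\<Sum>l\<in>E. \<Sum>i\<in>E. \<Sum>j\<in>E. g (mu i j) (P l) * g (mu i j) l)
        = (\<Sum>a\<in>E. \<Sum>c\<in>E. dmetric (mu a c) (mu a c) (G o\<^sub>L B))"
    proof -
      have Psym: "g X (P Y) = g (P X) Y" for X Y using B by (simp add: tangent_blocks_def)
      show ?thesis
        by (subst sum.swap, rule sum.cong[OF refl], subst sum.swap)
          (simp add: dmetric_tangent[OF B] Psym parseval[symmetric])
    qed
    have r: "ricci mu g (P l) l = (\<Sum>i\<in>E. \<Sum>j\<in>E. g (mu i j) (P l) * g (mu i j) l) / 4
        - N (P l) l / 2 - killing (P l) l / 2" for l
      unfolding ricci_formula N_def killing_def ..
    show ?thesis
      unfolding D_def sum.distrib 1 2 3 r sum_subtractf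
      by (simp add: 4 sum_divide_distrib[symmetric])
  qed
  ultimately show ?thesis by blast
qed

definition F_of :: "'a endo \<Rightarrow> 'a \<Rightarrow> 'a \<Rightarrow> 'a \<Rightarrow> real" where
  "F_of G' = H_of mu H G'"

lemma F_of_base: "F_of G = F" by (simp add: F_of_def H_of_eq)

lemma F_of_three_form:
  assumes "G' \<in> gen_metrics" shows "three_form (F_of G')"
proof -
  interpret G': metric_b_pair "metric_of G'" "b_of G'" by (rule metric_b_field_props(1)[OF assms])
  have "three_form (d2 mu (b_of G'))" by (rule d2_three_form[OF mu mu_alt G'.b])
  with H show ?thesis unfolding three_form_def F_of_def H_of_def bilinear_def
    by (auto intro: linear_compose_add)
qed

lemma F_of_has_derivative:
  "((\<lambda>G'. F_of G' X Y Z) has_derivative (\<lambda>V. d2 mu (\<lambda>X Y. db_field X Y V) X Y Z))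
    (at G within gen_metrics)"
proof -
  have "((\<lambda>G'. H X Y Z + d2 mu (b_of G') X Y Z) has_derivative
      (\<lambda>V. 0 + d2 mu (\<lambda>X Y. db_field X Y V) X Y Z)) (at G within gen_metrics)"
    unfolding d2_def
    by (intro has_derivative_add has_derivative_diff has_derivative_minus has_derivative_const
        b_of_has_derivative)
  then show ?thesis by (simp add: F_of_def H_of_def[abs_def])
qed

lemma norm_sq3_metric_of:
  assumes G': "G' \<in> gen_metrics"
  shows "norm_sq3 (metric_of G') (F_of G') =
    (\<Sum>a\<in>E. \<Sum>l\<in>E. ginv a l G' * (\<Sum>c\<in>E. \<Sum>m\<in>E. ginv c m G' *
      (\<Sum>d\<in>E. \<Sum>n\<in>E. ginv d n G' * (F_of G' a c d * F_of G' l m n))))"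
proof -
  note ml = three_form_multilinear[OF F_of_three_form[OF G']]
  let ?E = "onb (metric_of G')"
  have b3: "bilinear (\<lambda>x y. F_of G' a c x * F_of G' l m y)" for a c l m
    using ml(1) unfolding bilinear_def by (auto intro!: linearI simp: linear_add linear_cmul algebra_simps)
  have b2: "bilinear (\<lambda>x y. \<Sum>k\<in>?E. F_of G' a x k * F_of G' l y k)" for a l
  proof (rule bilinear_sum_fun)
    show "bilinear (\<lambda>x y. F_of G' a x k * F_of G' l y k)" for k
      unfolding bilinear_def by (intro conjI allI linearI)
        (simp_all add: bilin_simps[OF ml(1)] algebra_simps)
  qed
  have b1: "bilinear (\<lambda>x y. \<Sum>j\<in>?E. \<Sum>k\<in>?E. F_of G' x j k * F_of G' y j k)"
  proof (intro bilinear_sum_fun)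
    show "bilinear (\<lambda>x y. F_of G' x j k * F_of G' y j k)" for j k
      unfolding bilinear_def by (intro conjI allI linearI)
        (simp_all add: bilin_simps[OF ml(2)] algebra_simps)
  qed
  show ?thesis
    unfolding norm_sq3_def power2_eq_square contraction_metric_of[OF G' b1]
    unfolding contraction_metric_of[OF G' b2]
    unfolding contraction_metric_of[OF G' b3] ..
qed

lemma square3_bilinear: "bilinear (square3 g F)"
  unfolding square3_def
proof (intro bilinear_sum_fun)
  show "bilinear (\<lambda>x y. F x j k * F y j k)" for j k
    unfolding bilinear_def by (intro conjI allI linearI)
      (simp_all add: bilin_simps[OF three_form_multilinear(2)[OF F_three_form]] algebra_simps)
qed

text \<open>Each of the three contractions in \<open>|F|\<^sup>2\<close> contributes the same \<open>- \<langle>F\<^sup>2, h\<rangle>\<close>, as \<open>F\<close> is skew. The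
  variation of \<open>F\<close> is \<open>d \<beta>\<close> with \<open>\<beta>\<close> the variation of \<open>b\<close>, and contributes
  \<open>2 \<langle>F, d \<beta>\<rangle> = 6 \<langle>d\<^sup>* F, \<beta>\<rangle>\<close>.\<close>

lemma norm_sq3_has_derivative:
  "\<exists>D. ((\<lambda>G'. norm_sq3 (metric_of G') (F_of G')) has_derivative D) (at G within gen_metrics) \<and>
    (\<forall>P Q B. tangent_blocks P Q B \<longrightarrow> D (G o\<^sub>L B) =
      - 3 * (\<Sum>l\<in>E. square3 g F (P l) l) + 6 * (\<Sum>l\<in>E. g (codiff_op l) (Q l)))"
proof -
  let ?f = "\<lambda>G'. \<Sum>a\<in>E. \<Sum>l\<in>E. ginv a l G' * (\<Sum>c\<in>E. \<Sum>m\<in>E. ginv c m G' *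
      (\<Sum>d\<in>E. \<Sum>n\<in>E. ginv d n G' * (F_of G' a c d * F_of G' l m n)))"
  define dF where "dF V X Y Z = d2 mu (\<lambda>X Y. db_field X Y V) X Y Z" for V X Y Z
  have dF: "((\<lambda>G'. F_of G' X Y Z) has_derivative (\<lambda>V. dF V X Y Z)) (at G within gen_metrics)" for X Y Z
    unfolding dF_def by (rule F_of_has_derivative)
  define D where "D V =
      (\<Sum>a\<in>E. \<Sum>l\<in>E. ginv a l V * (\<Sum>c\<in>E. \<Sum>m\<in>E. ginv c m G *
        (\<Sum>d\<in>E. \<Sum>n\<in>E. ginv d n G * (F_of G a c d * F_of G l m n)))) +
      (\<Sum>a\<in>E. (\<Sum>c\<in>E. \<Sum>m\<in>E. ginv c m V * (\<Sum>d\<in>E. \<Sum>n\<in>E. ginv d n G * (F_of G a c d * F_of G a m n))) +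
        (\<Sum>c\<in>E. (\<Sum>d\<in>E. \<Sum>n\<in>E. ginv d n V * (F_of G a c d * F_of G a c n)) +
          (\<Sum>d\<in>E. F_of G a c d * dF V a c d + dF V a c d * F_of G a c d)))" for V
  have "(?f has_derivative D) (at G within gen_metrics)"
    unfolding D_def[abs_def]
    by (intro contraction_has_derivative[OF fin ginv_delta ginv_has_derivative]
        has_derivative_mult dF)
  then have "((\<lambda>G'. norm_sq3 (metric_of G') (F_of G')) has_derivative D) (at G within gen_metrics)"
    by (rule has_derivative_transform[rotated 2]) (simp_all add: norm_sq3_metric_of gen_metric_of_mem)
  moreover have "D (G o\<^sub>L B) =
      - 3 * (\<Sum>l\<in>E. square3 g F (P l) l) + 6 * (\<Sum>l\<in>E. g (codiff_op l) (Q l))"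
    if B: "tangent_blocks P Q B" for P Q B
  proof -
    let ?V = "G o\<^sub>L B"
    have lin: "linear Q" using B by (simp add: tangent_blocks_def)
    have Qskew: "g (Q X) Y = - g X (Q Y)" for X Y using B by (simp add: tangent_blocks_def)
    have \<kappa>: "ginv a l ?V = - g a (P l)" for a l
      by (simp add: ginv_def upper_right_tangent[OF B] g_simps)
    have contr: "(\<Sum>a\<in>E. \<Sum>l\<in>E. ginv a l ?V * square3 g F a l) = - (\<Sum>l\<in>E. square3 g F (P l) l)"
      by (simp add: \<kappa> sum_negf sum_contract[OF square3_bilinear])
    have 1: "(\<Sum>a\<in>E. \<Sum>l\<in>E. ginv a l ?V * (\<Sum>c\<in>E. \<Sum>m\<in>E. ginv c m G *
        (\<Sum>d\<in>E. \<Sum>n\<in>E. ginv d n G * (F_of G a c d * F_of G l m n)))) = - (\<Sum>l\<in>E. square3 g F (P l) l)"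
      unfolding contr[symmetric] by (simp add: ginv_at_base F_of_base square3_def)
    have 2: "(\<Sum>a\<in>E. \<Sum>c\<in>E. \<Sum>m\<in>E. ginv c m ?V *
        (\<Sum>d\<in>E. \<Sum>n\<in>E. ginv d n G * (F_of G a c d * F_of G a m n))) = - (\<Sum>l\<in>E. square3 g F (P l) l)"
    proof -
      have sq: "(\<Sum>a\<in>E. \<Sum>d\<in>E. F a c d * F a m d) = square3 g F c m" for c m
        unfolding square3_def
        by (intro sum.cong refl) (simp add: three_form_skew(1)[OF F_three_form, of _ c] three_form_skew(1)[OF F_three_form, of _ m])
      then show ?thesis
        unfolding contr[symmetric] ginv_at_base F_of_base
        by (simp only: sum_contraction_swap sq)
    qed
    have 3: "(\<Sum>a\<in>E. \<Sum>c\<in>E. \<Sum>d\<in>E. \<Sum>n\<in>E. ginv d n ?V * (F_of G a c d * F_of G a c n))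
        = - (\<Sum>l\<in>E. square3 g F (P l) l)"
    proof -
      have rot: "F a c d = F d a c" for a c d
        using three_form_skew(2)[OF F_three_form, of a c d] three_form_skew(1)[OF F_three_form, of a d c] by simp
      have "(\<Sum>a\<in>E. \<Sum>c\<in>E. F a c d * F a c n) = square3 g F d n" for d n
        unfolding square3_def by (intro sum.cong refl) (simp only: rot[of _ _ d] rot[of _ _ n])
      moreover have "(\<Sum>a\<in>E. \<Sum>c\<in>E. \<Sum>d\<in>E. \<Sum>n\<in>E. ginv d n ?V * (F a c d * F a c n))
          = (\<Sum>d\<in>E. \<Sum>n\<in>E. ginv d n ?V * (\<Sum>a\<in>E. \<Sum>c\<in>E. F a c d * F a c n))"
        unfolding sum_contraction_swap ..
      ultimately show ?thesis unfolding contr[symmetric] by (simp add: F_of_base)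
    qed
    have 4: "(\<Sum>a\<in>E. \<Sum>c\<in>E. \<Sum>d\<in>E. F_of G a c d * dF ?V a c d + dF ?V a c d * F_of G a c d)
        = 6 * (\<Sum>l\<in>E. g (codiff_op l) (Q l))"
    proof -
      define \<beta> where "\<beta> X Y = g (Q X) Y" for X Y
      have "two_form \<beta>"
        unfolding two_form_def bilinear_def \<beta>_def
      proof (intro conjI allI)
        show "linear (g (Q x))" for x by (rule bilinear_linear(1)[OF g_bilinear])
        show "linear (\<lambda>x. g (Q x) y)" for y
          using lin by (intro linearI) (simp_all add: linear_add linear_cmul g_simps)
        show "g (Q X) X = 0" for X using Qskew[of X X] sym[of X "Q X"] by simp
      qed
      note adj = codiff3_adjoint[OF F_three_form this]
      have "dF ?V X Y Z = d2 mu \<beta> X Y Z" for X Y Z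
        by (simp add: dF_def \<beta>_def[abs_def] db_field_tangent[OF B])
      then have "(\<Sum>a\<in>E. \<Sum>c\<in>E. \<Sum>d\<in>E. F_of G a c d * dF ?V a c d + dF ?V a c d * F_of G a c d)
          = 2 * (\<Sum>a\<in>E. \<Sum>c\<in>E. \<Sum>d\<in>E. F a c d * d2 mu \<beta> a c d)"
        by (simp add: F_of_base sum_distrib_left mult.commute flip: mult_2)
      also have "\<dots> = 6 * (\<Sum>i\<in>E. \<Sum>j\<in>E. g (codiff_op i) j * g (Q i) j)"
        unfolding adj g_codiff_op[symmetric] \<beta>_def by simp
      finally show ?thesis by (simp add: parseval[symmetric])
    qed
    show ?thesis
      using 4 unfolding D_def sum.distrib 1 2 3 by linarith
  qed
  ultimately show ?thesis by blast
qed

text \<open>With \<open>h = g P\<close> and \<open>\<beta> = g Q\<close> the two variations combine to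
  \<open>- \<langle>Ric - F\<^sup>2/4, h\<rangle> - \<langle>d\<^sup>* F, \<beta>\<rangle>/2\<close>, which is the product of \<open>- 1/2\<close> times the blocks of the
  generalized Ricci curvature with the blocks \<open>P\<close> and \<open>Q\<close>.\<close>

lemma gen_scal_gradient:
  "has_sym_gradient (gen_scal mu H) G ((- (1/2)) *\<^sub>R gen_ricci mu H G)"
proof -
  obtain D1 where D1: "((\<lambda>G'. scal mu (metric_of G')) has_derivative D1) (at G within gen_metrics)"
    "\<And>P Q B. tangent_blocks P Q B \<Longrightarrow> D1 (G o\<^sub>L B) = - (\<Sum>l\<in>E. ricci mu g (P l) l)"
    using scal_has_derivative by blast
  obtain D2 where D2: "((\<lambda>G'. norm_sq3 (metric_of G') (F_of G')) has_derivative D2) (at G within gen_metrics)"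
    "\<And>P Q B. tangent_blocks P Q B \<Longrightarrow> D2 (G o\<^sub>L B) =
      - 3 * (\<Sum>l\<in>E. square3 g F (P l) l) + 6 * (\<Sum>l\<in>E. g (codiff_op l) (Q l))"
    using norm_sq3_has_derivative by blast
  let ?A = "(- (1/2)) *\<^sub>R gen_ricci mu H G"
  have A: "tangent_blocks (\<lambda>X. (- (1/2)) *\<^sub>R ric_op X) (\<lambda>X. (- (1/2)) *\<^sub>R (1/2) *\<^sub>R codiff_op X) ?A"
  proof -
    have "blinfun_apply ?A (frame X Y) = (- (1/2)) *\<^sub>R blinfun_apply (gen_ricci mu H G) (frame X Y)" for X Y
      by (rule blinfun.scaleR_left)
    with gen_ricci_blocks show ?thesis
      unfolding tangent_blocks_def
      by (auto intro!: linear_compose_neg linear_compose_scale_right linear_ric_op linear_codiff_op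
        simp: frame_scaleR frame_uminus g_simps scaleR_diff_right scaleR_add_right)
  qed
  have "(gen_scal mu H has_derivative (\<lambda>V. D1 V - D2 V / 12)) (at G within gen_metrics)"
    unfolding gen_scal_def[abs_def] Let_def F_of_def[symmetric]
    by (intro has_derivative_diff D1(1) bounded_linear.has_derivative[OF bounded_linear_divide] D2(1))
  moreover have "sym_metric ?A B = D1 (G o\<^sub>L B) - D2 (G o\<^sub>L B) / 12"
    if tangent: "B \<in> tangent_endos G" for B
  proof -
    obtain P Q where B: "tangent_blocks P Q B" using tangent tangent_endos_iff by blast
    have "g (P l) (ric_op l) = ricci mu g (P l) l - square3 g F (P l) l / 4" for l
      by (simp add: sym[of "P l"] g_ric_op ric_form_sym[of l]) (simp add: ric_form_def)
    then have "(\<Sum>l\<in>E. g (P l) (ric_op l)) =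
        (\<Sum>l\<in>E. ricci mu g (P l) l) - (\<Sum>l\<in>E. square3 g F (P l) l) / 4"
      by (simp add: sum_subtractf sum_divide_distrib)
    then show ?thesis
      unfolding sym_metric_frame[OF A B] D1(2)[OF B] D2(2)[OF B]
      by (simp add: g_simps sum_negf sum_divide_distrib[symmetric] sym[of "Q _"] field_simps)
  qed
  moreover have "?A \<in> tangent_endos G" using A tangent_endos_iff by blast
  ultimately show ?thesis unfolding has_sym_gradient_def by blast
qed

end

theorem corollary3p3:
  fixes mu :: "'a::euclidean_space \<Rightarrow> 'a \<Rightarrow> 'a"
    and H :: "'a \<Rightarrow> 'a \<Rightarrow> 'a \<Rightarrow> real"
    and muH :: "'a double \<Rightarrow> 'a double \<Rightarrow> 'a double"
    and G :: "'a endo"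
  assumes "exact_courant_data mu H muH"
    and "unimodular mu"
    and "G \<in> gen_metrics"
  shows "has_sym_gradient (gen_scal mu H) G (sym_grad (gen_scal mu H) G) \<and>
         gen_ricci mu H G = - 2 *\<^sub>R sym_grad (gen_scal mu H) G"
proof -
  obtain g b where gb: "inner_product g" "two_form b" "G = gen_metric_of g b"
    using gen_metric_exists[OF assms(3)] by blast
  interpret gen_metric_on_lie g b mu H
    using assms gb by unfold_locales (auto simp: exact_courant_data_def lie_bracket_def)
  have grad: "has_sym_gradient (gen_scal mu H) G ((- (1/2)) *\<^sub>R gen_ricci mu H G)"
    unfolding gb(3) by (rule gen_scal_gradient)
  then have "sym_grad (gen_scal mu H) G = (- (1/2)) *\<^sub>R gen_ricci mu H G"
    unfolding sym_grad_def using sym_gradient_unique[OF assms(3)] by (intro the_equality) blast+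
  with grad show ?thesis by simp
qed

end
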